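(* Let $n_0 \ge 1$. Suppose the following holds: for every continuous unital homomorphism $\theta : A(\mathbb{D}) \to M_{n_0}(\mathbb{C})$ and every unital antilinear contraction $\alpha : A(\mathbb{D}) \to A(\mathbb{D})$ such that the map $$\theta_\alpha(f) := \tfrac12\bigl(\theta(f)+\theta(\alpha(f))^*\bigr)$$ satisfies $\|\theta_\alpha\| \le 1$, one has $\|\theta\| \le 2$. Then for every $T \in M_{n_0}(\mathbb{C})$ and every polynomial $p$, $$\|p(T)\| \le 2\max_{z \in W(T)} |p(z)|.$$
   Context: $\mathbb{D}$ is the open unit disk. $A(\mathbb{D})$ is the disk algebra: the continuous functions on $\overline{\mathbb{D}}$ that are holomorphic on $\mathbb{D}$, with the supremum norm. $M_{n_0}(\mathbb{C})$ carries the operator norm. A map $\alpha$ is antilinear if $\alpha(\lambda f+g)=\overline{\lambda}\alpha(f)+\alpha(g)$. It is a contraction if $\|\alpha(f)\|\le\|f\|$, and it is unital if $\alpha(1)=1$. Homomorphisms are unital. $W(T)=\{\langle Tx,x\rangle : \|x\|=1\}$ is the numerical range of $T$. *)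

theory Defs
  imports "HOL-Analysis.Analysis" "HOL-Computational_Algebra.Polynomial"
begin

text \<open>The disk algebra A(D), as a set of functions on the complex plane
  (only their values on the closed unit disk matter).\<close>
definition disk_algebra :: "(complex \<Rightarrow> complex) set" where
  "disk_algebra = {f. continuous_on (cball 0 1) f \<and> f holomorphic_on ball 0 1}"

definition supnorm :: "(complex \<Rightarrow> complex) \<Rightarrow> real" where
  "supnorm f = (SUP z\<in>cball 0 1. cmod (f z))"

definition mnorm :: "complex^'n^'n \<Rightarrow> real" where
  "mnorm A = onorm (\<lambda>x. A *v x)"

definition mscale :: "complex \<Rightarrow> complex^'n^'n \<Rightarrow> complex^'n^'n" where
  "mscale c A = (\<chi> i j. c * A $ i $ j)"

definition adjoint_mat :: "complex^'n^'n \<Rightarrow> complex^'n^'n" where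
  "adjoint_mat A = (\<chi> i j. cnj (A $ j $ i))"

definition map_norm :: "((complex \<Rightarrow> complex) \<Rightarrow> complex^'n^'n) \<Rightarrow> real" where
  "map_norm \<Phi> = (SUP f\<in>{f\<in>disk_algebra. supnorm f \<le> 1}. mnorm (\<Phi> f))"

definition cont_unital_hom :: "((complex \<Rightarrow> complex) \<Rightarrow> complex^'n^'n) \<Rightarrow> bool" where
  "cont_unital_hom \<theta> \<longleftrightarrow>
     (\<forall>f\<in>disk_algebra. \<forall>g\<in>disk_algebra. \<forall>c::complex.
         \<theta> (\<lambda>z. c * f z + g z) = mscale c (\<theta> f) + \<theta> g) \<and>
     (\<forall>f\<in>disk_algebra. \<forall>g\<in>disk_algebra. \<theta> (\<lambda>z. f z * g z) = \<theta> f ** \<theta> g) \<and>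
     \<theta> (\<lambda>z. 1) = mat 1 \<and>
     (\<exists>C. \<forall>f\<in>disk_algebra. mnorm (\<theta> f) \<le> C * supnorm f)"

definition unital_antilinear_contraction :: "((complex \<Rightarrow> complex) \<Rightarrow> (complex \<Rightarrow> complex)) \<Rightarrow> bool" where
  "unital_antilinear_contraction \<alpha> \<longleftrightarrow>
     (\<forall>f\<in>disk_algebra. \<alpha> f \<in> disk_algebra) \<and>
     (\<forall>f\<in>disk_algebra. \<forall>g\<in>disk_algebra. \<forall>c::complex.
         \<alpha> (\<lambda>z. c * f z + g z) = (\<lambda>z. cnj c * \<alpha> f z + \<alpha> g z)) \<and>
     (\<forall>f\<in>disk_algebra. supnorm (\<alpha> f) \<le> supnorm f) \<and>
     \<alpha> (\<lambda>z. 1) = (\<lambda>z. 1)"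

definition theta_alpha ::
  "((complex \<Rightarrow> complex) \<Rightarrow> complex^'n^'n) \<Rightarrow> ((complex \<Rightarrow> complex) \<Rightarrow> (complex \<Rightarrow> complex))
     \<Rightarrow> (complex \<Rightarrow> complex) \<Rightarrow> complex^'n^'n" where
  "theta_alpha \<theta> \<alpha> f = mscale (1/2) (\<theta> f + adjoint_mat (\<theta> (\<alpha> f)))"

definition cinner :: "complex^'n \<Rightarrow> complex^'n \<Rightarrow> complex" where
  "cinner x y = (\<Sum>i\<in>UNIV. x $ i * cnj (y $ i))"

definition numerical_range :: "complex^'n^'n \<Rightarrow> complex set" where
  "numerical_range T = {cinner (T *v x) x | x. norm x = 1}"

fun matpow :: "complex^'n^'n \<Rightarrow> nat \<Rightarrow> complex^'n^'n" where
  "matpow T 0 = mat 1"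
| "matpow T (Suc k) = T ** matpow T k"

definition poly_mat :: "complex poly \<Rightarrow> complex^'n^'n \<Rightarrow> complex^'n^'n" where
  "poly_mat p T = (\<Sum>k\<le>degree p. mscale (coeff p k) (matpow T k))"

end

theory Submission
  imports Defs "HOL-Complex_Analysis.Complex_Analysis"
    "HOL-Computational_Algebra.Fundamental_Theorem_Algebra"
begin

text \<open>Let \<open>\<Omega>\<close> be a bounded convex neighbourhood of W(T). By Study's theorem a Riemann map of
  \<open>\<Omega>\<close> maps concentric disks to convex sets, so a slightly smaller disk gives a chart \<open>\<phi>\<close> that is
  conformal across the closed unit disk, has convex image and still covers W(T). With \<open>\<psi>\<close> the
  inverse chart, take \<open>\<theta>\<close>(f) = (f o \<open>\<psi>\<close>)(T) and, following Crouzeix and Palencia, let \<open>\<alpha>\<close>(f) be the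
  Cauchy transform of the conjugate of f on the boundary curve. On the boundary \<open>\<alpha>\<close>(f) is the
  integral of conj(f) against the double layer potential, which convexity makes a probability
  measure; hence \<open>\<alpha>\<close> is a contraction. In \<open>\<theta>\<close>(f) + \<open>\<theta>\<close>(\<open>\<alpha>\<close>(f))* the Cauchy kernel of T is replaced by
  twice its real part, which is positive semidefinite since W(T) lies inside the convex curve, so
  that the hypothesis applies. Every p(T) is \<open>\<theta>\<close>(p o \<open>\<phi>\<close>), and \<open>\<Omega>\<close> shrinks to W(T), which is
  convex by the Toeplitz--Hausdorff theorem.\<close>

section \<open>Complex matrices\<close>

text \<open>The contraction estimate is needed on the boundary curve, where the Cauchy kernel is
  singular. In the disk variable that kernel splits into \<open>u / (u - z)\<close>, which against
  \<open>cnj (f u)\<close> yields only the constant \<open>cnj (f 0)\<close>, and a kernel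
  \<open>hker\<close> that is continuous across the diagonal. Hence no principal values or jump
  relations occur. On the unit circle \<open>Re (u / (u - z))\<close> is exactly 1/2, so the sign of
  the double layer potential can be read off from \<open>hker\<close>. A single inequality,
  \<open>Re_kernel_nonneg\<close>, gives both this sign and the positivity for \<open>T\<close>.

  All integrals are scalar. As \<open>T\<close> is annihilated by a product of linear factors, its
  resolvent is a finite Newton sum with known poles, and Hermite interpolation makes the functional
  calculus multiplicative without a resolvent identity. The factor 1/2 in \<open>theta_alpha\<close>
  balances the mass: the kernel of \<open>T\<close> has mean 1, and so does its adjoint.\<close>

lemma mscale_vector: "mscale c A *v x = c *s (A *v x)"
  by (simp add: mscale_def matrix_vector_mult_def vec_eq_iff sum_distrib_left mult.assoc)

lemma mscale_mult_left: "mscale c A ** B = mscale c (A ** B)"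
  by (simp add: mscale_def matrix_matrix_mult_def vec_eq_iff sum_distrib_left mult.assoc)

lemma mscale_mult_right: "A ** mscale c B = mscale c (A ** B)"
  by (simp add: mscale_def matrix_matrix_mult_def vec_eq_iff sum_distrib_left algebra_simps)

lemma mscale_add_right: "mscale c (A + B) = mscale c A + mscale c B"
  by (simp add: mscale_def vec_eq_iff algebra_simps)

lemma mscale_add_left: "mscale (a + b) A = mscale a A + mscale b A"
  by (simp add: mscale_def vec_eq_iff algebra_simps)

lemma mscale_mscale: "mscale a (mscale b A) = mscale (a * b) A"
  by (simp add: mscale_def vec_eq_iff algebra_simps)

lemma mscale_0 [simp]: "mscale 0 A = 0"
  by (simp add: mscale_def vec_eq_iff)

lemma mscale_1 [simp]: "mscale 1 A = A"
  by (simp add: mscale_def vec_eq_iff)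

lemma mscale_zero_right [simp]: "mscale c 0 = 0"
  by (simp add: mscale_def vec_eq_iff)

lemma matrix_mult_sum_right: "A ** sum f S = (\<Sum>i\<in>S. A ** f i)" for A :: "complex^'n^'n"
  by (induction S rule: infinite_finite_induct) (auto simp: matrix_add_ldistrib)

lemma matrix_mult_zero_right [simp]: "A ** (0 :: complex^'n^'n) = 0"
  by (simp add: matrix_matrix_mult_def vec_eq_iff)

lemma matrix_mult_zero_left [simp]: "(0 :: complex^'n^'n) ** A = 0"
  by (simp add: matrix_matrix_mult_def vec_eq_iff)

lemma matrix_mult_add_left: "(A + B) ** C = A ** C + B ** C" for C :: "complex^'n^'n"
  by (simp add: matrix_matrix_mult_def vec_eq_iff sum.distrib distrib_right)

section \<open>Polynomials evaluated at a matrix\<close>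

lemma poly_mat_0 [simp]: "poly_mat 0 T = 0"
  by (simp add: poly_mat_def)

lemma poly_mat_pCons: "poly_mat (pCons a p) T = mscale a (mat 1) + T ** poly_mat p T"
proof (cases "p = 0")
  case True
  then show ?thesis by (simp add: poly_mat_def)
next
  case False
  have "poly_mat (pCons a p) T = (\<Sum>k\<le>Suc (degree p). mscale (coeff (pCons a p) k) (matpow T k))"
    using False by (simp add: poly_mat_def)
  also have "\<dots> = mscale a (mat 1) + (\<Sum>k\<le>degree p. mscale (coeff p k) (T ** matpow T k))"
    by (subst sum.atMost_Suc_shift) simp
  also have "\<dots> = mscale a (mat 1) + T ** poly_mat p T"
    by (simp add: poly_mat_def matrix_mult_sum_right mscale_mult_right)
  finally show ?thesis .
qed

lemma poly_mat_add: "poly_mat (p + q) T = poly_mat p T + poly_mat q T"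
proof (induction p q rule: poly_induct2)
  case (pCons a p b q)
  then show ?case
    by (simp add: poly_mat_pCons mscale_add_left matrix_add_ldistrib)
qed simp

lemma poly_mat_smult: "poly_mat (smult c p) T = mscale c (poly_mat p T)"
  by (induction p) (simp_all add: poly_mat_pCons mscale_add_right mscale_mscale mscale_mult_right)

lemma poly_mat_mult: "poly_mat (p * q) T = poly_mat p T ** poly_mat q T"
proof (induction p)
  case (pCons a p)
  then show ?case
    by (simp add: poly_mat_add poly_mat_smult poly_mat_pCons matrix_mult_add_left matrix_mul_assoc
        mscale_mult_left)
qed simp

lemma poly_mat_linear_factor: "poly_mat [:- l, 1:] T = T - mscale l (mat 1)"
  by (simp add: poly_mat_pCons mscale_def vec_eq_iff)

lemma poly_mat_monom: "poly_mat (monom c k) T = mscale c (matpow T k)"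
  by (induction k) (simp_all add: monom_0 monom_Suc poly_mat_pCons mscale_mult_right)

lemma poly_mat_sum: "poly_mat (sum f S) T = (\<Sum>i\<in>S. poly_mat (f i) T)"
  by (induction S rule: infinite_finite_induct) (auto simp: poly_mat_add)

lemma mscale_of_real: "mscale (of_real c) A = c *\<^sub>R A"
  by (simp add: mscale_def vec_eq_iff) (simp add: scaleR_conv_of_real)

text \<open>Infinitely many distinct powers of \<open>T\<close> are linearly dependent in a
  finite-dimensional real space. A repeated power is treated separately, because dependence of the
  set of powers does not see repetitions.\<close>

lemma exists_annihilating_poly:
  fixes T :: "complex^'n^'n"
  shows "\<exists>p. p \<noteq> 0 \<and> poly_mat p T = 0"
proof (cases "inj (matpow T)")
  case False
  then obtain i j where ij: "i \<noteq> j" "matpow T i = matpow T j"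
    by (auto simp: inj_def)
  have "poly_mat (monom 1 i + smult (-1) (monom 1 j)) T = 0"
    by (simp only: poly_mat_add poly_mat_smult poly_mat_monom ij(2))
       (simp add: mscale_def vec_eq_iff)
  moreover have "monom 1 i + smult (-1) (monom 1 j) \<noteq> (0 :: complex poly)"
    using ij(1) by (auto simp: poly_eq_iff dest: spec[of _ i])
  ultimately show ?thesis by blast
next
  case True
  then have "infinite (range (matpow T))"
    by (simp add: range_inj_infinite)
  then have "dependent (range (matpow T))"
    using independent_bound by blast
  then obtain S u where S: "finite S" "S \<subseteq> range (matpow T)"
    and z: "(\<Sum>v\<in>S. u v *\<^sub>R v) = 0" and nz: "\<exists>v\<in>S. u v \<noteq> 0"
    unfolding dependent_explicit by blast
  obtain K where K: "S = matpow T ` K"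
    using S(2) by (auto simp: subset_image_iff)
  have inj: "inj_on (matpow T) K"
    using True by (rule inj_on_subset) auto
  have fK: "finite K"
    using S(1) K inj by (simp add: finite_image_iff)
  define p where "p = (\<Sum>k\<in>K. monom (complex_of_real (u (matpow T k))) k)"
  have "poly_mat p T = (\<Sum>k\<in>K. u (matpow T k) *\<^sub>R matpow T k)"
    by (simp add: p_def poly_mat_sum poly_mat_monom mscale_of_real)
  also have "\<dots> = 0"
    using z inj by (simp add: K sum.reindex)
  finally have "poly_mat p T = 0" .
  moreover obtain k where "k \<in> K" "u (matpow T k) \<noteq> 0"
    using nz K by auto
  then have "coeff p k \<noteq> 0"
    using fK by (simp add: p_def coeff_sum)
  then have "p \<noteq> 0" by auto
  ultimately show ?thesis by blast
qed

lemma matrix_eq_0_iff: "A = 0 \<longleftrightarrow> (\<forall>x. A *v x = 0)" for A :: "complex^'n^'n"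
  by (auto simp: matrix_eq)

section \<open>The sesquilinear form and the operator norm\<close>

lemma norm_scale_complex [simp]: "norm (c *s x) = cmod c * norm x" for x :: "complex^'n"
  by (simp add: norm_vec_def L2_set_def norm_mult power_mult_distrib flip: sum_distrib_left)
     (simp add: real_sqrt_mult)

lemma norm_cinner: "complex_of_real ((norm x)\<^sup>2) = cinner x x"
  by (simp add: cinner_def norm_vec_def L2_set_def sum_nonneg complex_norm_square[symmetric] of_real_sum
      del: of_real_power)

lemma cinner_add_left: "cinner (x + y) z = cinner x z + cinner y z"
  by (simp add: cinner_def sum.distrib algebra_simps)

lemma cinner_add_right: "cinner x (y + z) = cinner x y + cinner x z"
  by (simp add: cinner_def sum.distrib algebra_simps)

lemma cinner_diff_left: "cinner (x - y) z = cinner x z - cinner y z"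
  by (simp add: cinner_def sum_subtractf algebra_simps)

lemma cinner_diff_right: "cinner x (y - z) = cinner x y - cinner x z"
  by (simp add: cinner_def sum_subtractf algebra_simps)

lemma cinner_scale_left [simp]: "cinner (c *s x) z = c * cinner x z"
  by (simp add: cinner_def sum_distrib_left algebra_simps)

lemma cinner_scale_right [simp]: "cinner x (c *s z) = cnj c * cinner x z"
  by (simp add: cinner_def sum_distrib_left algebra_simps)

lemma cinner_commute: "cinner x y = cnj (cinner y x)"
  by (simp add: cinner_def mult.commute)

lemma cinner_adjoint: "cinner (adjoint_mat A *v x) y = cnj (cinner (A *v y) x)"
proof -
  have "cinner (adjoint_mat A *v x) y = (\<Sum>i\<in>UNIV. \<Sum>j\<in>UNIV. cnj (A$j$i) * x$j * cnj (y$i))"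
    by (simp add: cinner_def adjoint_mat_def matrix_vector_mult_def sum_distrib_right)
  also have "\<dots> = (\<Sum>j\<in>UNIV. \<Sum>i\<in>UNIV. cnj (A$j$i) * x$j * cnj (y$i))"
    by (rule sum.swap)
  also have "\<dots> = cnj (cinner (A *v y) x)"
    by (simp add: cinner_def matrix_vector_mult_def sum_distrib_left sum_distrib_right algebra_simps)
  finally show ?thesis .
qed

lemma continuous_on_cinner [continuous_intros]:
  fixes f g :: "'a::topological_space \<Rightarrow> complex^'n"
  assumes "continuous_on S f" "continuous_on S g"
  shows "continuous_on S (\<lambda>z. cinner (f z) (g z))"
  unfolding cinner_def using assms by (intro continuous_intros)

lemma continuous_on_matrix_vector [continuous_intros]:
  fixes f :: "'a::topological_space \<Rightarrow> complex^'n^'n"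
  assumes "continuous_on S f" "continuous_on S g"
  shows "continuous_on S (\<lambda>z. f z *v g z)"
  unfolding matrix_vector_mult_def using assms by (intro continuous_intros)

text \<open>Taking \<open>y\<close> in the direction of \<open>A *v x\<close> recovers the norm of
  \<open>A *v x\<close>. All operator norm estimates below thus become estimates of scalar
  integrals.\<close>

lemma mnorm_le:
  fixes A :: "complex^'n^'n"
  assumes "\<And>x y. norm x = 1 \<Longrightarrow> norm y = 1 \<Longrightarrow> cmod (cinner (A *v x) y) \<le> C" "0 \<le> C"
  shows "mnorm A \<le> C"
  unfolding mnorm_def
proof (rule onorm_bound[OF assms(2)])
  fix x :: "complex^'n"
  have unit: "norm (A *v x) \<le> C" if "norm x = 1" for x :: "complex^'n"
  proof (cases "A *v x = 0")
    case True
    then show ?thesis using assms(2) by simp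
  next
    case False
    define y where "y = complex_of_real (1 / norm (A *v x)) *s (A *v x)"
    have "norm y = 1" using False by (simp add: y_def norm_divide)
    then have "cmod (cinner (A *v x) y) \<le> C" using assms(1) that by blast
    moreover have "cinner (A *v x) y = complex_of_real (1 / norm (A *v x)) * complex_of_real ((norm (A *v x))\<^sup>2)"
      by (simp only: y_def cinner_scale_right norm_cinner complex_cnj_complex_of_real)
    then have "cinner (A *v x) y = complex_of_real (norm (A *v x))"
      using False by (simp add: power2_eq_square)
    ultimately show ?thesis by simp
  qed
  show "norm (A *v x) \<le> C * norm x"
  proof (cases "x = 0")
    case False
    define u where "u = complex_of_real (1 / norm x) *s x"
    have "norm u = 1" using False by (simp add: u_def norm_divide)
    then have "norm (A *v u) \<le> C" by (rule unit)
    then show ?thesis using False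
      by (simp add: u_def vector_scalar_commute norm_divide field_simps)
  qed simp
qed

lemma mnorm_mscale: "mnorm (mscale c A) = cmod c * mnorm A" for A :: "complex^'n^'n"
proof -
  have "mnorm (mscale c A) = onorm (\<lambda>x. cmod c *\<^sub>R (A *v x))"
    unfolding mnorm_def onorm_def by (simp add: mscale_vector)
  also have "\<dots> = cmod c * mnorm A"
    unfolding mnorm_def
    by (subst onorm_scaleR) (simp_all add: linear_conv_bounded_linear[symmetric])
  finally show ?thesis .
qed

lemma cmod_cinner_entries_le:
  fixes A :: "complex^'n^'n"
  assumes "\<And>i j. cmod (A$i$j) \<le> B" "norm x = 1" "norm y = 1"
  shows "cmod (cinner (A *v x) y) \<le> real (CARD('n) * CARD('n)) * B"
proof -
  have B: "0 \<le> B" using assms(1) norm_ge_zero order_trans by blast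
  have c: "cmod (v$i) \<le> 1" if "norm v = 1" for v :: "complex^'n" and i
    using that Finite_Cartesian_Product.norm_nth_le[of v i] by simp
  have "cinner (A *v x) y = (\<Sum>i\<in>UNIV. \<Sum>j\<in>UNIV. A$i$j * x$j * cnj (y$i))"
    by (simp add: cinner_def matrix_vector_mult_def sum_distrib_right)
  also have "cmod \<dots> \<le> (\<Sum>i\<in>(UNIV::'n set). \<Sum>j\<in>(UNIV::'n set). B)"
  proof (intro sum_norm_le)
    fix i j :: 'n
    have "cmod (A$i$j * x$j * cnj (y$i)) \<le> B * 1 * 1"
      unfolding norm_mult complex_mod_cnj
      by (intro mult_mono assms c) (use B in auto)
    then show "cmod (A$i$j * x$j * cnj (y$i)) \<le> B" by simp
  qed
  finally show ?thesis by simp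
qed

text \<open>The zeros of an annihilating polynomial of minimal degree are eigenvalues.\<close>

lemma annihilating_eigenvalues:
  fixes T :: "complex^'n^'n"
  obtains ls where "poly_mat (\<Prod>l\<leftarrow>ls. [:- l, 1:]) T = 0" "set ls \<subseteq> numerical_range T"
proof -
  obtain p where p: "p \<noteq> 0" "poly_mat p T = 0"
    and min: "\<And>q. q \<noteq> 0 \<Longrightarrow> poly_mat q T = 0 \<Longrightarrow> degree p \<le> degree q"
    using exists_annihilating_poly[of T]
      ex_has_least_nat[of "\<lambda>p. p \<noteq> 0 \<and> poly_mat p T = 0" _ degree] by blast
  obtain A where A: "p = smult (lead_coeff p) (\<Prod>x\<in>#A. [:-x, 1:])"
    using alg_closed_imp_factorization[OF p(1)] by blast
  obtain ls where ls: "mset ls = A" using ex_mset by blast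
  have eq: "p = smult (lead_coeff p) (\<Prod>l\<leftarrow>ls. [:- l, 1:])"
    using A by (metis ls mset_map prod_mset_prod_list)
  have "mscale (lead_coeff p) (poly_mat (\<Prod>l\<leftarrow>ls. [:- l, 1:]) T) = 0"
    using p(2) eq by (metis poly_mat_smult)
  then have "poly_mat (\<Prod>l\<leftarrow>ls. [:- l, 1:]) T = 0"
    using p(1) by (simp add: mscale_def vec_eq_iff)
  moreover have "l \<in> numerical_range T" if "l \<in> set ls" for l
  proof -
    have "poly (\<Prod>l\<leftarrow>ls. [:- l, 1:]) l = 0"
      using that by (induction ls) auto
    then have "poly p l = 0" by (subst eq) simp
    then obtain q where q: "p = [:- l, 1:] * q"
      using poly_eq_0_iff_dvd by (metis dvdE)
    have "q \<noteq> 0" using p(1) q by auto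
    moreover have "degree p = Suc (degree q)"
      using \<open>q \<noteq> 0\<close> unfolding q by (subst degree_mult_eq) auto
    \<comment> \<open>By minimality the cofactor does not annihilate \<open>T\<close>, so some
      vector survives \<open>poly_mat q T\<close>. What survives is killed by
      \<open>T - l\<close>.\<close>
    ultimately have "poly_mat q T \<noteq> 0" using min by fastforce
    then obtain x where x: "poly_mat q T *v x \<noteq> 0" by (auto simp: matrix_eq_0_iff)
    define v where "v = poly_mat q T *v x"
    have "(T - mscale l (mat 1)) *v v = 0"
      using p(2) unfolding q poly_mat_mult poly_mat_linear_factor v_def
      by (simp add: matrix_vector_mul_assoc)
    then have Tv: "T *v v = l *s v"
      by (simp add: matrix_vector_mult_diff_rdistrib mscale_vector)
    define u where "u = complex_of_real (1 / norm v) *s v"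
    have u: "norm u = 1" using x by (simp add: u_def v_def norm_divide)
    have "T *v u = l *s u"
      by (simp add: u_def vector_scalar_commute Tv vector_smult_assoc mult.commute)
    then have "cinner (T *v u) u = l"
      using norm_cinner[of u] u by simp
    then show ?thesis using u by (force simp: numerical_range_def)
  qed
  ultimately show ?thesis using that by blast
qed

section \<open>The numerical range\<close>

lemma cinner_matrix_scale: "cinner (T *v (c *s x)) (d *s y) = c * cnj d * cinner (T *v x) y"
  by (simp add: vector_scalar_commute algebra_simps)

lemma numerical_range_memI:
  assumes "x \<noteq> 0"
  shows "cinner (T *v x) x / cinner x x \<in> numerical_range T"
proof -
  define c where "c = complex_of_real (1 / norm x)"
  have "norm (c *s x) = 1" using assms by (simp add: c_def norm_divide)
  moreover have "cinner (T *v (c *s x)) (c *s x) = cinner (T *v x) x / cinner x x"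
    by (simp only: cinner_matrix_scale norm_cinner[symmetric])
       (simp add: c_def power2_eq_square)
  ultimately show ?thesis unfolding numerical_range_def by (metis (mono_tags, lifting) mem_Collect_eq)
qed

lemma compact_numerical_range: "compact (numerical_range (T :: complex^'n^'n))"
proof -
  have "numerical_range T = (\<lambda>x. cinner (T *v x) x) ` sphere 0 1"
    by (auto simp: numerical_range_def)
  then show ?thesis
    by (auto intro!: compact_continuous_image continuous_intros)
qed

lemma numerical_range_nonempty: "numerical_range (T :: complex^'n^'n) \<noteq> {}"
proof -
  have "norm (axis undefined 1 :: complex^'n) = 1" by simp
  then show ?thesis unfolding numerical_range_def by blast
qed

text \<open>Toeplitz--Hausdorff: after normalising the two values to 0 and 1, rotating one of the vectors
  makes the quadratic form real along the segment joining the vectors, so the intermediate value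
  theorem applies.\<close>

lemma convex_numerical_range: "convex (numerical_range (T :: complex^'n^'n))"
proof (rule convexI)
  fix a b :: complex and u v :: real
  assume ab: "a \<in> numerical_range T" "b \<in> numerical_range T" and uv: "0 \<le> u" "0 \<le> v" "u + v = 1"
  obtain x where x: "norm x = 1" "cinner (T *v x) x = a" using ab(1) by (auto simp: numerical_range_def)
  obtain y where y: "norm y = 1" "cinner (T *v y) y = b" using ab(2) by (auto simp: numerical_range_def)
  show "u *\<^sub>R a + v *\<^sub>R b \<in> numerical_range T"
  proof (cases "a = b")
    case True
    then show ?thesis using ab uv by (simp flip: scaleR_left_distrib)
  next
    case False
    \<comment> \<open>The form of \<open>(T - a) / (b - a)\<close>, with value 0 at \<open>x\<close>
      and 1 at \<open>y\<close>.\<close>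
    define A where "A x y = (cinner (T *v x) y - a * cinner x y) / (b - a)" for x y
    have A_add: "A (s + t) w = A s w + A t w" "A w (s + t) = A w s + A w t" for s t w
      by (simp_all add: A_def cinner_add_left cinner_add_right matrix_vector_right_distrib field_simps
          add_divide_distrib diff_divide_distrib)
    have A_scale: "A (c *s s) (d *s t) = c * cnj d * A s t" for c d s t
      by (simp add: A_def vector_scalar_commute algebra_simps)
    have "cinner x x = 1" "cinner y y = 1" using norm_cinner[of x] norm_cinner[of y] x y by simp_all
    then have Axx: "A x x = 0" and Ayy: "A y y = 1"
      using x y False by (simp_all add: A_def)
    \<comment> \<open>The cross terms for \<open>c *s x\<close> and \<open>y\<close> have the
      imaginary part of \<open>c * g\<close>; the phase \<open>c\<close> is chosen to make
      \<open>c * g\<close> real.\<close>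
    define g where "g = A x y - cnj (A y x)"
    define c where "c = (if g = 0 then 1 else cnj g / cmod g)"
    have c: "cmod c = 1" by (simp add: c_def norm_divide)
    have cg: "Im (c * g) = 0"
      by (simp add: c_def mult.commute)
    define x' where "x' = c *s x"
    have Ax': "A x' x' = 0" using A_scale[of c x c x] Axx by (simp add: x'_def)
    have x'0: "x' \<noteq> 0" using c x by (metis norm_scale_complex norm_zero mult_1 x'_def zero_neq_one)
    have cross: "Im (A x' y + A y x') = 0"
    proof -
      have "A x' y = c * A x y" using A_scale[of c x 1 y] by (simp add: x'_def)
      moreover have "A y x' = cnj c * A y x" using A_scale[of 1 y c x] by (simp add: x'_def)
      ultimately show ?thesis using cg by (simp add: g_def algebra_simps)
    qed
    define z where "z t = complex_of_real (1 - t) *s x' + complex_of_real t *s y" for t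
    \<comment> \<open>The two vectors are independent because the form separates them:
      \<open>t *s y = (t - 1) *s x'\<close> would give \<open>t * t = 0\<close>.\<close>
    have z0: "z t \<noteq> 0" for t
    proof
      assume "z t = 0"
      then have "complex_of_real t *s y = complex_of_real (t - 1) *s x'"
        by (simp add: z_def vec_eq_iff algebra_simps eq_neg_iff_add_eq_0)
      then have "complex_of_real t * cnj (of_real t) * A y y = complex_of_real (t-1) * cnj (of_real (t-1)) * A x' x'"
        by (metis A_scale)
      then have "t = 0" by (simp add: Ax' Ayy)
      then show False using \<open>z t = 0\<close> x'0 by (simp add: z_def)
    qed
    have Im: "Im (A (z t) (z t)) = 0" for t
    proof -
      have "A (z t) (z t) = complex_of_real ((1 - t) * t) * (A x' y + A y x') + complex_of_real (t * t)"
        unfolding z_def A_add A_scale Ax' Ayy by (simp add: algebra_simps)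
      then show ?thesis using cross by simp
    qed
    define f where "f t = Re (A (z t) (z t)) / (norm (z t))\<^sup>2" for t
    have "continuous_on {0..1} z"
      unfolding z_def vector_scalar_mult_def
      by (intro continuous_intros)
    then have "continuous_on {0..1} f"
      unfolding f_def A_def using z0 False by (intro continuous_intros) auto
    moreover have "f 0 = 0" "f 1 = 1"
      using y by (simp_all add: f_def z_def Ax' Ayy)
    ultimately obtain t where t: "f t = v"
      using IVT'[of f 0 v 1] uv by auto
    have n: "cinner (z t) (z t) \<noteq> 0"
      using z0[of t] by (simp flip: norm_cinner)
    have "A (z t) (z t) = complex_of_real (f t) * cinner (z t) (z t)"
      using z0[of t] Im[of t] by (simp add: f_def complex_eq_iff flip: norm_cinner)
    then have "cinner (T *v z t) (z t) = (a + v * (b - a)) * cinner (z t) (z t)"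
      using False by (simp add: A_def t field_simps)
    then have "cinner (T *v z t) (z t) / cinner (z t) (z t) = a + v * (b - a)"
      using n by simp
    also have "a + v * (b - a) = u *\<^sub>R a + v *\<^sub>R b"
    proof -
      have "u = 1 - v" using uv(3) by simp
      show ?thesis unfolding \<open>u = 1 - v\<close> by (simp add: scaleR_conv_of_real algebra_simps)
    qed
    finally show ?thesis
      using numerical_range_memI[OF z0, of T t] by simp
  qed
qed

section \<open>Means over circles\<close>

text \<open>This is the contour integral of \<open>g u / u\<close> over the circle, divided by
  \<open>2 * pi * \<i>\<close>. The division by \<open>u\<close> is why Cauchy kernels below read
  \<open>u / (u - z)\<close> and derivatives of the chart carry a factor \<open>u\<close>.\<close>

definition circle_mean :: "real \<Rightarrow> (complex \<Rightarrow> complex) \<Rightarrow> complex" where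
  "circle_mean r g = integral {0..1} (\<lambda>t. g (circlepath 0 r t))"

lemma norm_circlepath [simp]: "0 \<le> r \<Longrightarrow> norm (circlepath 0 r t) = r"
  by (simp add: circlepath norm_mult)

lemma continuous_on_circlepath [continuous_intros]:
  "continuous_on S g \<Longrightarrow> continuous_on S (\<lambda>x. circlepath 0 r (g x))"
  unfolding circlepath by (intro continuous_intros)

lemma circle_integrable:
  fixes g :: "complex \<Rightarrow> complex"
  assumes "continuous_on (sphere 0 r) g" "0 \<le> r"
  shows "(\<lambda>t. g (circlepath 0 r t)) integrable_on {0..1}"
proof (rule integrable_continuous_interval[where 'b=real])
  have "continuous_on {0..1} (circlepath 0 r)"
    using continuous_on_circlepath[OF continuous_on_id] by simp
  then show "continuous_on {0..1} (\<lambda>t. g (circlepath 0 r t))"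
    by (rule continuous_on_compose2[OF assms(1)]) (use assms(2) in auto)
qed

lemma circle_mean_cong:
  assumes "\<And>z. z \<in> sphere 0 r \<Longrightarrow> f z = g z" "0 \<le> r"
  shows "circle_mean r f = circle_mean r g"
  unfolding circle_mean_def using assms by (intro integral_cong) auto

lemma circle_mean_add:
  assumes "continuous_on (sphere 0 r) f" "continuous_on (sphere 0 r) g" "0 \<le> r"
  shows "circle_mean r (\<lambda>z. f z + g z) = circle_mean r f + circle_mean r g"
  unfolding circle_mean_def using assms by (intro integral_add circle_integrable)

lemma circle_mean_cmult: "circle_mean r (\<lambda>z. c * f z) = c * circle_mean r f"
  unfolding circle_mean_def by (rule integral_mult_right)

lemma circle_mean_sum:
  assumes "\<And>i. i \<in> I \<Longrightarrow> continuous_on (sphere 0 r) (f i)" "finite I" "0 \<le> r"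
  shows "circle_mean r (\<lambda>z. \<Sum>i\<in>I. f i z) = (\<Sum>i\<in>I. circle_mean r (f i))"
  unfolding circle_mean_def using assms by (intro integral_sum circle_integrable)

lemma circle_mean_cnj: "circle_mean r (\<lambda>z. cnj (f z)) = cnj (circle_mean r f)"
  unfolding circle_mean_def by (rule integral_cnj[symmetric])

lemma circle_mean_zero [simp]: "circle_mean r (\<lambda>z. 0) = 0"
  by (simp add: circle_mean_def)

lemma circle_mean_one [simp]: "circle_mean r (\<lambda>z. 1) = 1"
  by (simp add: circle_mean_def)

text \<open>Only the real part of the majorant enters, so a complex kernel can serve directly as a
  weight.\<close>

lemma circle_mean_norm_le:
  assumes "continuous_on (sphere 0 r) f" "continuous_on (sphere 0 r) w" "0 \<le> r"
    and "\<And>z. z \<in> sphere 0 r \<Longrightarrow> norm (f z) \<le> Re (w z)"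
  shows "norm (circle_mean r f) \<le> Re (circle_mean r w)"
proof -
  have w: "(\<lambda>t. w (circlepath 0 r t)) integrable_on {0..1}"
    by (rule circle_integrable[OF assms(2,3)])
  have "norm (circle_mean r f) \<le> integral {0..1} (\<lambda>t. Re (w (circlepath 0 r t)))"
    unfolding circle_mean_def
    using assms(3,4) integrable_linear[OF w bounded_linear_Re]
    by (intro integral_norm_bound_integral circle_integrable[OF assms(1,3)]) (auto simp: o_def)
  then show ?thesis
    using integral_linear[OF w bounded_linear_Re] by (simp add: circle_mean_def o_def)
qed

lemma circle_mean_contour:
  assumes "((\<lambda>u. g u / u) has_contour_integral (2 * of_real pi * \<i> * v)) (circlepath 0 r)" "r \<noteq> 0"
  shows "circle_mean r g = v"
proof -
  have "((\<lambda>t. g (circlepath 0 r t) / circlepath 0 r t *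
      vector_derivative (circlepath 0 r) (at t)) has_integral (2 * of_real pi * \<i> * v)) {0..1}"
    using assms(1) by (simp add: has_contour_integral vector_derivative_at_within_ivl)
  then have "((\<lambda>t. (2 * of_real pi * \<i>) * g (circlepath 0 r t)) has_integral (2 * of_real pi * \<i> * v)) {0..1}"
    using assms(2)
    by (elim has_integral_eq[rotated]) (simp only: vector_derivative_circlepath, simp add: circlepath)
  then have "((\<lambda>t. (1 / (2 * of_real pi * \<i>)) * ((2 * of_real pi * \<i>) * g (circlepath 0 r t))) has_integral
      (1 / (2 * of_real pi * \<i>)) * (2 * of_real pi * \<i> * v)) {0..1}"
    by (rule has_integral_mult_right)
  then show ?thesis
    unfolding circle_mean_def by (intro integral_unique) simp
qed

lemma circle_mean_holomorphic:
  assumes "continuous_on (cball 0 r) f" "f holomorphic_on ball 0 r" "0 < r"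
  shows "circle_mean r f = f 0"
  using Cauchy_integral_circlepath[OF assms(1,2), of 0] assms(3)
  by (intro circle_mean_contour) auto

lemma circle_mean_Cauchy:
  assumes "continuous_on (cball 0 r) f" "f holomorphic_on ball 0 r" "norm z < r"
  shows "circle_mean r (\<lambda>u. f u * (u / (u - z))) = f z"
proof (rule circle_mean_contour)
  have "r > 0" using assms(3) norm_ge_zero le_less_trans by blast
  then show "r \<noteq> 0" by simp
  have "((\<lambda>u. f u / (u - z)) has_contour_integral (2 * of_real pi * \<i> * f z)) (circlepath 0 r)"
    using Cauchy_integral_circlepath[OF assms(1,2), of z] assms(3) by simp
  then show "((\<lambda>u. f u * (u / (u - z)) / u) has_contour_integral 2 * of_real pi * \<i> * f z) (circlepath 0 r)"
    by (rule has_contour_integral_eq) (use \<open>r > 0\<close> in \<open>auto simp: path_image_circlepath\<close>)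
qed

lemma circle_mean_primitive:
  assumes "\<And>u. u \<in> sphere 0 r \<Longrightarrow> (F has_field_derivative f u) (at u)" "0 < r"
  shows "circle_mean r (\<lambda>u. u * f u) = 0"
proof (rule circle_mean_contour)
  have "(f has_contour_integral 0) (circlepath 0 r)"
    using contour_integral_primitive[of "sphere 0 r" F f "circlepath 0 r"] assms
    by (auto simp: has_field_derivative_at_within path_image_circlepath)
  then show "((\<lambda>u. u * f u / u) has_contour_integral 2 * of_real pi * \<i> * 0) (circlepath 0 r)"
    by (simp, elim has_contour_integral_eq) (use assms(2) in \<open>auto simp: path_image_circlepath\<close>)
qed (use assms(2) in simp)

text \<open>On the unit circle \<open>cnj u = 1 / u\<close>, so the Cauchy kernel is the conjugate
  of a function holomorphic in \<open>u\<close> with value 1 at 0. The mean value property then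
  leaves only the value at the centre.\<close>

lemma circle_mean_cnj_Cauchy:
  assumes "continuous_on (cball 0 1) f" "f holomorphic_on ball 0 1" "norm z < 1"
  shows "circle_mean 1 (\<lambda>u. cnj (f u) * (u / (u - z))) = cnj (f 0)"
proof -
  have nz: "1 - cnj z * u \<noteq> 0" if "u \<in> cball 0 1" for u
  proof
    assume "1 - cnj z * u = 0"
    then have "cmod (cnj z * u) = 1" by (metis eq_iff_diff_eq_0 norm_one)
    moreover have "cmod (cnj z * u) \<le> cmod z * 1"
      unfolding norm_mult complex_mod_cnj using that by (intro mult_left_mono) auto
    ultimately show False using assms(3) by simp
  qed
  have "circle_mean 1 (\<lambda>u. cnj (f u) * (u / (u - z))) = circle_mean 1 (\<lambda>u. cnj (f u / (1 - cnj z * u)))"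
  proof (rule circle_mean_cong)
    fix u :: complex assume "u \<in> sphere 0 1"
    then have u: "u * cnj u = 1" by (simp add: complex_norm_square[symmetric])
    then have "u * (1 - z * cnj u) = u - z"
      by (simp add: right_diff_distrib mult.left_commute)
    moreover have "u \<noteq> 0" using u by auto
    ultimately have "u / (u - z) = 1 / (1 - z * cnj u)"
      by (metis div_by_1 mult_divide_mult_cancel_left mult.right_neutral)
    then show "cnj (f u) * (u / (u - z)) = cnj (f u / (1 - cnj z * u))" by simp
  qed simp
  also have "\<dots> = cnj (circle_mean 1 (\<lambda>u. f u / (1 - cnj z * u)))"
    by (rule circle_mean_cnj)
  also have "circle_mean 1 (\<lambda>u. f u / (1 - cnj z * u)) = f 0 / (1 - cnj z * 0)"
    by (rule circle_mean_holomorphic)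
       (use nz in \<open>auto intro!: continuous_intros holomorphic_intros assms\<close>)
  finally show ?thesis by simp
qed

lemma circle_mean_swap:
  assumes "continuous_on (sphere 0 r \<times> sphere 0 s) (\<lambda>(x, y). f x y)" "0 \<le> r" "0 \<le> s"
  shows "circle_mean r (\<lambda>x. circle_mean s (f x)) = circle_mean s (\<lambda>y. circle_mean r (\<lambda>x. f x y))"
proof -
  have "continuous_on (cbox (0::real,0::real) (1,1)) (\<lambda>p. (circlepath 0 r (fst p), circlepath 0 s (snd p)))"
    by (intro continuous_intros)
  then have "continuous_on (cbox (0::real,0::real) (1,1))
      (\<lambda>p. (\<lambda>(x, y). f x y) (circlepath 0 r (fst p), circlepath 0 s (snd p)))"
    by (rule continuous_on_compose2[OF assms(1)]) (use assms(2,3) in auto)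
  then have "continuous_on (cbox (0::real,0::real) (1,1)) (\<lambda>(x, y). f (circlepath 0 r x) (circlepath 0 s y))"
    by (simp add: case_prod_beta)
  from integral_swap_continuous[OF this] show ?thesis
    by (simp add: circle_mean_def)
qed

section \<open>Conformal charts of convex domains\<close>

text \<open>Convexity is assumed only for the image of the large disk of radius \<open>s\<close>.
  The margin between 1 and \<open>s\<close> makes the image of the unit circle an analytic curve;
  that this curve is convex is derived, in infinitesimal form, in
  \<open>Re_kernel_nonneg\<close>.\<close>

locale convex_chart =
  fixes \<phi> \<psi> :: "complex \<Rightarrow> complex" and s :: real and \<Omega> :: "complex set"
  assumes s_gt_1: "1 < s"
    and open_\<Omega>: "open \<Omega>"
    and convex_\<Omega>: "convex \<Omega>"
    and hol_\<phi>: "\<phi> holomorphic_on ball 0 s"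
    and hol_\<psi>: "\<psi> holomorphic_on \<Omega>"
    and \<phi>_mem: "z \<in> ball 0 s \<Longrightarrow> \<phi> z \<in> \<Omega>"
    and \<psi>_mem: "w \<in> \<Omega> \<Longrightarrow> \<psi> w \<in> ball 0 s"
    and \<psi>_\<phi>: "z \<in> ball 0 s \<Longrightarrow> \<psi> (\<phi> z) = z"
    and \<phi>_\<psi>: "w \<in> \<Omega> \<Longrightarrow> \<phi> (\<psi> w) = w"
begin

lemma \<phi>_eq_iff: "y \<in> ball 0 s \<Longrightarrow> z \<in> ball 0 s \<Longrightarrow> \<phi> y = \<phi> z \<longleftrightarrow> y = z"
  by (metis \<psi>_\<phi>)

lemma cball_subset: "cball 0 1 \<subseteq> ball 0 s"
  using s_gt_1 by auto

lemma \<phi>_has_deriv: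
  assumes "z \<in> ball 0 s"
  shows "(\<phi> has_field_derivative deriv \<phi> z) (at z)"
  using assms hol_\<phi> by (metis holomorphic_derivI open_ball)

lemma deriv_chain:
  assumes "z \<in> ball 0 s"
  shows "deriv \<psi> (\<phi> z) * deriv \<phi> z = 1"
proof -
  have "(\<psi> has_field_derivative deriv \<psi> (\<phi> z)) (at (\<phi> z))"
    using hol_\<psi> open_\<Omega> \<phi>_mem[OF assms] by (metis holomorphic_derivI)
  from DERIV_chain2[OF this \<phi>_has_deriv[OF assms]]
  have "((\<lambda>x. \<psi> (\<phi> x)) has_field_derivative deriv \<psi> (\<phi> z) * deriv \<phi> z) (at z)" .
  moreover have "((\<lambda>x. \<psi> (\<phi> x)) has_field_derivative 1) (at z)"
    by (rule has_field_derivative_transform_within_open[OF DERIV_ident open_ball assms])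
       (simp add: \<psi>_\<phi>)
  ultimately show ?thesis by (rule DERIV_unique)
qed

lemma deriv_\<phi>_nz: "z \<in> ball 0 s \<Longrightarrow> deriv \<phi> z \<noteq> 0"
  using deriv_chain by fastforce

text \<open>Study's argument: the Schwarz lemma applied to a convex combination of rotated copies of the
  chart.\<close>

lemma norm_chart_segment_le:
  assumes z: "z \<in> ball 0 s" and yz: "norm y \<le> norm z" and t: "0 \<le> t" "t \<le> 1"
  shows "norm (\<psi> ((1 - t) *\<^sub>R \<phi> z + t *\<^sub>R \<phi> y)) \<le> norm z"
proof (cases "z = 0")
  case True
  then have "(1 - t) *\<^sub>R \<phi> z + t *\<^sub>R \<phi> y = \<phi> 0"
    using yz by (simp flip: scaleR_left_distrib)
  then show ?thesis using True \<psi>_\<phi>[of 0] s_gt_1 by simp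
next
  case False
  define c where "c = y / z"
  have c: "norm c \<le> 1" using yz False by (simp add: c_def norm_divide divide_simps)
  have s0: "0 < s" using s_gt_1 by simp
  \<comment> \<open>A self-map of the unit disk fixing 0. Since \<open>y = z * c\<close>, its value
    at \<open>z / s\<close> is the pulled-back point of the segment, divided by
    \<open>s\<close>.\<close>
  define G where "G u = \<psi> ((1 - t) *\<^sub>R \<phi> (of_real s * u) + t *\<^sub>R \<phi> (of_real s * u * c)) / of_real s" for u
  have b1: "of_real s * u \<in> ball 0 s" if "norm u < 1" for u :: complex
    using that s0 by (simp add: norm_mult)
  have b2: "of_real s * u * c \<in> ball 0 s" if "norm u < 1" for u :: complex
  proof -
    have "norm u * norm c \<le> norm u * 1" by (intro mult_left_mono c) simp
    then have "s * (norm u * norm c) < s * 1" using that s0 by (intro mult_strict_left_mono) auto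
    then show ?thesis using s0 by (simp add: norm_mult mult.assoc)
  qed
  have mem: "(1 - t) *\<^sub>R \<phi> (of_real s * u) + t *\<^sub>R \<phi> (of_real s * u * c) \<in> \<Omega>" if "norm u < 1" for u
    using convexD_alt[OF convex_\<Omega> \<phi>_mem[OF b1[OF that]] \<phi>_mem[OF b2[OF that]] t] .
  have "(\<lambda>u. \<phi> (of_real s * u)) holomorphic_on ball 0 1"
    by (rule holomorphic_on_compose_gen[OF _ hol_\<phi>, unfolded o_def])
       (use b1 in \<open>auto intro!: holomorphic_intros\<close>)
  moreover have "(\<lambda>u. \<phi> (of_real s * u * c)) holomorphic_on ball 0 1"
    by (rule holomorphic_on_compose_gen[OF _ hol_\<phi>, unfolded o_def])
       (use b2 in \<open>auto intro!: holomorphic_intros\<close>)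
  ultimately have "(\<lambda>u. (1 - t) *\<^sub>R \<phi> (of_real s * u) + t *\<^sub>R \<phi> (of_real s * u * c)) holomorphic_on ball 0 1"
    unfolding scaleR_conv_of_real by (intro holomorphic_intros)
  then have "(\<lambda>u. \<psi> ((1 - t) *\<^sub>R \<phi> (of_real s * u) + t *\<^sub>R \<phi> (of_real s * u * c))) holomorphic_on ball 0 1"
    by (rule holomorphic_on_compose_gen[OF _ hol_\<psi>, unfolded o_def]) (use mem in auto)
  then have "G holomorphic_on ball 0 1"
    unfolding G_def using s0 by (intro holomorphic_intros) auto
  moreover have "G 0 = 0"
    using \<psi>_\<phi>[of 0] s0 by (simp add: G_def flip: scaleR_left_distrib)
  moreover have "norm (G u) < 1" if "norm u < 1" for u
    using \<psi>_mem[OF mem[OF that]] s0 by (simp add: G_def norm_divide)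
  moreover have "norm (z / of_real s) < 1" using z s0 by (simp add: norm_divide)
  ultimately have "norm (G (z / of_real s)) \<le> norm (z / of_real s)"
    by (rule Schwarz_Lemma(1))
  then show ?thesis
    using s0 False by (simp add: G_def c_def norm_divide divide_simps)
qed

text \<open>The segment from \<open>\<phi> z\<close> to \<open>\<phi> y\<close>, pulled back to the
  disk, never has norm above \<open>norm z\<close> by \<open>norm_chart_segment_le\<close>. A
  negative real part would make its squared norm increase strictly at the start. Geometrically,
  \<open>z * deriv \<phi> z\<close> is an outward normal of the image of the circle through
  \<open>z\<close>, and the image of the closed disk lies behind the tangent line.\<close>

lemma Re_kernel_nonneg:
  assumes z: "z \<in> ball 0 s" "z \<noteq> 0" and yz: "norm y \<le> norm z"
  shows "0 \<le> Re ((\<phi> z - \<phi> y) / (z * deriv \<phi> z))"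
proof (rule ccontr)
  assume neg: "\<not> ?thesis"
  \<comment> \<open>The initial velocity of the pulled-back segment \<open>p\<close>.\<close>
  define d where "d = deriv \<psi> (\<phi> z) * (\<phi> y - \<phi> z)"
  define p where "p t = \<psi> (\<phi> z + of_real t * (\<phi> y - \<phi> z))" for t :: real
  have "deriv \<psi> (\<phi> z) = 1 / deriv \<phi> z"
    using deriv_chain[OF z(1)] deriv_\<phi>_nz[OF z(1)] by (simp add: field_simps)
  then have d: "d = - (\<phi> z - \<phi> y) / deriv \<phi> z"
    by (simp add: d_def minus_divide_left)
  define Q where "Q = (\<phi> z - \<phi> y) / (z * deriv \<phi> z)"
  have "cnj z * d = of_real (- (norm z)\<^sup>2) * Q"
    using z(2) by (simp add: d Q_def complex_norm_square right_diff_distrib diff_divide_distrib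
        del: of_real_power)
  then have "Re (cnj z * d) = - (norm z)\<^sup>2 * Re Q"
    by (metis Re_complex_of_real Im_complex_of_real times_complex.sel(1) mult_zero_left diff_zero)
  then have pos: "0 < 2 * (z \<bullet> d)"
    using neg z(2) by (simp add: inner_complex_def mult_less_0_iff Q_def)
  have der: "(\<psi> has_field_derivative deriv \<psi> (\<phi> z)) (at (\<phi> z))"
    using hol_\<psi> open_\<Omega> \<phi>_mem[OF z(1)] by (metis holomorphic_derivI)
  have "((\<lambda>t. \<phi> z + of_real t * (\<phi> y - \<phi> z)) has_vector_derivative (\<phi> y - \<phi> z)) (at 0 within {0..1})"
    by (auto intro!: derivative_eq_intros)
  then have "(p has_vector_derivative (\<phi> y - \<phi> z) * deriv \<psi> (\<phi> z)) (at 0 within {0..1})"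
    unfolding p_def
    by (intro field_vector_diff_chain_within[unfolded o_def, where g = \<psi>])
       (use der in \<open>auto intro: has_field_derivative_at_within\<close>)
  then have pd: "(p has_vector_derivative d) (at 0 within {0..1})"
    by (simp add: d_def mult.commute)
  have p0: "p 0 = z" by (simp add: p_def \<psi>_\<phi>[OF z(1)])
  have "((\<lambda>t. p t \<bullet> p t) has_real_derivative 2 * (z \<bullet> d)) (at 0 within {0..1})"
    using has_derivative_inner[OF pd[unfolded has_vector_derivative_def] pd[unfolded has_vector_derivative_def]]
    by (simp add: has_field_derivative_def p0 inner_commute[of d z] mult_commute_abs algebra_simps)
  from has_real_derivative_pos_inc_right[OF this pos]
  obtain e where e: "e > 0" "\<And>h. h > 0 \<Longrightarrow> h \<in> {0..1} \<Longrightarrow> h < e \<Longrightarrow> p 0 \<bullet> p 0 < p h \<bullet> p h"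
    by auto
  define h where "h = min 1 (e/2)"
  have h: "0 < h" "h \<le> 1" "h < e" using e(1) by (auto simp: h_def)
  have "p h = \<psi> ((1 - h) *\<^sub>R \<phi> z + h *\<^sub>R \<phi> y)"
    by (simp add: p_def scaleR_conv_of_real algebra_simps)
  then have "norm (p h) \<le> norm z" using norm_chart_segment_le[OF z(1) yz] h by simp
  then have "p h \<bullet> p h \<le> z \<bullet> z" by (simp add: dot_square_norm)
  then show False using e(2)[of h] h p0 by simp
qed

text \<open>The second-order Taylor remainder of \<open>\<phi>\<close> at \<open>\<zeta>\<close>,
  divided by \<open>(z - \<zeta>)\<^sup>2\<close>. The integral form is jointly continuous,
  including on the diagonal, where a quotient would need a limit.\<close>

definition rem2 :: "complex \<Rightarrow> complex \<Rightarrow> complex" where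
  "rem2 \<zeta> z = integral {0..1} (\<lambda>t. of_real (1 - t) * deriv (deriv \<phi>) (\<zeta> + of_real t * (z - \<zeta>)))"

lemma segment_mem:
  fixes \<zeta> z :: complex
  assumes "\<zeta> \<in> ball 0 s" "z \<in> ball 0 s" "t \<in> {0..1}"
  shows "\<zeta> + of_real t * (z - \<zeta>) \<in> ball 0 s"
proof -
  have "(1 - t) *\<^sub>R \<zeta> + t *\<^sub>R z \<in> ball 0 s"
    using assms by (intro convexD_alt[OF convex_ball]) auto
  then show ?thesis by (simp only: scaleR_conv_of_real of_real_diff) (simp add: algebra_simps)
qed

lemma hol_deriv: "deriv \<phi> holomorphic_on ball 0 s"
  by (intro holomorphic_deriv hol_\<phi> open_ball)

lemma hol_deriv2: "deriv (deriv \<phi>) holomorphic_on ball 0 s"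
  by (intro holomorphic_deriv hol_deriv open_ball)

lemma Taylor_rem2:
  assumes "\<zeta> \<in> ball 0 s" "z \<in> ball 0 s"
  shows "\<phi> \<zeta> - \<phi> z = (\<zeta> - z) * (deriv \<phi> \<zeta> - (\<zeta> - z) * rem2 \<zeta> z)"
proof -
  define d where "d = z - \<zeta>"
  show ?thesis
  proof (cases "d = 0")
    case False
    \<comment> \<open>Integration by parts suggests this primitive: it runs from the first-order
      Taylor polynomial at \<open>t = 0\<close> to \<open>\<phi> z\<close> at
      \<open>t = 1\<close>.\<close>
    have D: "((\<lambda>t. of_real (1 - t) * deriv \<phi> (\<zeta> + of_real t * d) * d + \<phi> (\<zeta> + of_real t * d))
        has_vector_derivative of_real (1 - t) * deriv (deriv \<phi>) (\<zeta> + of_real t * d) * d\<^sup>2) (at t within {0..1})"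
      if "t \<in> {0..1}" for t
    proof -
      have m: "\<zeta> + of_real t * d \<in> ball 0 s" using segment_mem[OF assms that] by (simp add: d_def)
      have 1: "(\<phi> has_field_derivative deriv \<phi> (\<zeta> + of_real t * d)) (at (\<zeta> + of_real t * d))"
        using m by (rule \<phi>_has_deriv)
      have 2: "(deriv \<phi> has_field_derivative deriv (deriv \<phi>) (\<zeta> + of_real t * d)) (at (\<zeta> + of_real t * d))"
        using m hol_deriv by (metis holomorphic_derivI open_ball)
      have 3: "((\<lambda>t. \<zeta> + of_real t * d) has_vector_derivative d) (at t within {0..1})"
        by (auto intro!: derivative_eq_intros)
      note 4 = field_vector_diff_chain_within[unfolded o_def, OF 3 has_field_derivative_at_within[OF 1]]
      note 5 = field_vector_diff_chain_within[unfolded o_def, OF 3 has_field_derivative_at_within[OF 2]]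
      have 6: "((\<lambda>t. of_real (1 - t) * d) has_vector_derivative - d) (at t within {0..1})"
        by (auto intro!: derivative_eq_intros)
      from has_vector_derivative_add[OF has_vector_derivative_mult[OF 6 5] 4]
      show ?thesis by (simp add: algebra_simps power2_eq_square)
    qed
    have "((\<lambda>t. of_real (1 - t) * deriv (deriv \<phi>) (\<zeta> + of_real t * d) * d\<^sup>2) has_integral
        (\<phi> z - (deriv \<phi> \<zeta> * d + \<phi> \<zeta>))) {0..1}"
      using fundamental_theorem_of_calculus[OF _ D] by (simp add: d_def)
    then have "integral {0..1} (\<lambda>t. of_real (1 - t) * deriv (deriv \<phi>) (\<zeta> + of_real t * d) * d\<^sup>2) =
        \<phi> z - (deriv \<phi> \<zeta> * d + \<phi> \<zeta>)"
      by (rule integral_unique)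
    then have "rem2 \<zeta> z * d\<^sup>2 = \<phi> z - (deriv \<phi> \<zeta> * d + \<phi> \<zeta>)"
      by (simp only: integral_mult_left) (simp add: rem2_def d_def)
    then show ?thesis by (simp add: d_def algebra_simps power2_eq_square)
  qed (simp add: d_def)
qed

lemma rem2_continuous: "continuous_on (ball 0 s \<times> ball 0 s) (\<lambda>(\<zeta>, z). rem2 \<zeta> z)"
proof -
  have "continuous_on ((ball 0 s \<times> ball 0 s) \<times> cbox (0::real) 1)
      (\<lambda>p. deriv (deriv \<phi>) (fst (fst p) + of_real (snd p) * (snd (fst p) - fst (fst p))))"
    by (rule continuous_on_compose2[OF holomorphic_on_imp_continuous_on[OF hol_deriv2]])
       (use segment_mem in \<open>auto intro!: continuous_intros\<close>)
  then have "continuous_on ((ball 0 s \<times> ball 0 s) \<times> cbox (0::real) 1)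
      (\<lambda>(x, t). of_real (1 - t) * deriv (deriv \<phi>) (fst x + of_real t * (snd x - fst x)))"
    by (auto intro!: continuous_intros simp: case_prod_beta)
  from integral_continuous_on_param[OF this] show ?thesis
    by (simp add: rem2_def case_prod_beta)
qed

text \<open>The difference quotient of \<open>\<phi>\<close>, completed by the derivative on the
  diagonal. Writing it through \<open>rem2\<close> makes its joint continuity immediate.\<close>

definition dquot :: "complex \<Rightarrow> complex \<Rightarrow> complex" where
  "dquot \<zeta> z = deriv \<phi> \<zeta> - (\<zeta> - z) * rem2 \<zeta> z"

lemma dquot_eq:
  assumes "\<zeta> \<in> ball 0 s" "z \<in> ball 0 s"
  shows "\<phi> \<zeta> - \<phi> z = (\<zeta> - z) * dquot \<zeta> z"
  using Taylor_rem2[OF assms] by (simp add: dquot_def)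

lemma dquot_nz:
  assumes "\<zeta> \<in> ball 0 s" "z \<in> ball 0 s"
  shows "dquot \<zeta> z \<noteq> 0"
proof (cases "\<zeta> = z")
  case True
  then show ?thesis using deriv_\<phi>_nz[OF assms(1)] by (simp add: dquot_def)
next
  case False
  then show ?thesis using dquot_eq[OF assms] \<phi>_eq_iff[OF assms] by auto
qed

lemma dquot_continuous: "continuous_on (ball 0 s \<times> ball 0 s) (\<lambda>(\<zeta>, z). dquot \<zeta> z)"
proof -
  have "continuous_on (ball 0 s \<times> ball 0 s) (\<lambda>p. deriv \<phi> (fst p))"
    by (rule continuous_on_compose2[OF holomorphic_on_imp_continuous_on[OF hol_deriv]])
       (auto intro!: continuous_intros)
  then show ?thesis
    using rem2_continuous by (auto simp: dquot_def case_prod_beta intro!: continuous_intros)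
qed

text \<open>The part of the Cauchy kernel of the chart that is regular on the diagonal.\<close>

definition hker :: "complex \<Rightarrow> complex \<Rightarrow> complex" where
  "hker \<zeta> z = \<zeta> * rem2 \<zeta> z / dquot \<zeta> z"

lemma hker_0 [simp]: "hker 0 z = 0"
  by (simp add: hker_def)

lemma hker_off_diag:
  assumes "\<zeta> \<in> ball 0 s" "z \<in> ball 0 s" "\<zeta> \<noteq> z"
  shows "hker \<zeta> z = \<zeta> * deriv \<phi> \<zeta> / (\<phi> \<zeta> - \<phi> z) - \<zeta> / (\<zeta> - z)"
proof -
  have "\<zeta> * deriv \<phi> \<zeta> / (\<phi> \<zeta> - \<phi> z) - \<zeta> / (\<zeta> - z) =
      (\<zeta> * deriv \<phi> \<zeta> - \<zeta> * dquot \<zeta> z) / ((\<zeta> - z) * dquot \<zeta> z)"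
    using assms(3) dquot_nz[OF assms(1,2)] by (simp add: dquot_eq[OF assms(1,2)] diff_divide_distrib)
  also have "\<zeta> * deriv \<phi> \<zeta> - \<zeta> * dquot \<zeta> z = (\<zeta> - z) * (\<zeta> * rem2 \<zeta> z)"
    by (simp add: dquot_def algebra_simps)
  finally show ?thesis using assms(3) by (simp add: hker_def)
qed

lemma hker_continuous: "continuous_on (ball 0 s \<times> ball 0 s) (\<lambda>(\<zeta>, z). hker \<zeta> z)"
  using rem2_continuous dquot_continuous
  by (auto simp: hker_def case_prod_beta dquot_nz intro!: continuous_intros)

lemma hker_continuous1:
  assumes "z \<in> ball 0 s"
  shows "continuous_on (ball 0 s) (\<lambda>\<zeta>. hker \<zeta> z)"
proof -
  have "continuous_on (ball 0 s) (\<lambda>\<zeta>. (\<lambda>(\<zeta>, z). hker \<zeta> z) (\<zeta>, z))"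
    by (rule continuous_on_compose2[OF hker_continuous]) (use assms in \<open>auto intro!: continuous_intros\<close>)
  then show ?thesis by simp
qed

lemma hker_continuous2:
  assumes "\<zeta> \<in> ball 0 s"
  shows "continuous_on (ball 0 s) (hker \<zeta>)"
proof -
  have "continuous_on (ball 0 s) (\<lambda>z. (\<lambda>(\<zeta>, z). hker \<zeta> z) (\<zeta>, z))"
    by (rule continuous_on_compose2[OF hker_continuous]) (use assms in \<open>auto intro!: continuous_intros\<close>)
  then show ?thesis by simp
qed

text \<open>The explicit formula is holomorphic off the diagonal point, and continuity makes the
  singularity there removable.\<close>

lemma hker_holomorphic1:
  assumes "z \<in> ball 0 s"
  shows "(\<lambda>\<zeta>. hker \<zeta> z) holomorphic_on ball 0 s"
proof (rule no_isolated_singularity[OF hker_continuous1[OF assms] _ open_ball, of "{z}"])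
  have "(\<lambda>\<zeta>. \<zeta> * deriv \<phi> \<zeta> / (\<phi> \<zeta> - \<phi> z) - \<zeta> / (\<zeta> - z)) holomorphic_on ball 0 s - {z}"
    using \<phi>_eq_iff[OF _ assms]
    by (intro holomorphic_intros holomorphic_on_subset[OF hol_\<phi>] holomorphic_on_subset[OF hol_deriv]) auto
  then show "(\<lambda>\<zeta>. hker \<zeta> z) holomorphic_on ball 0 s - {z}"
    by (rule holomorphic_transform) (use hker_off_diag[OF _ assms] in auto)
qed simp

end

lemma continuous_on_circle_mean_param:
  assumes "continuous_on (U \<times> sphere 0 r) (\<lambda>(x, u). g x u)" "0 \<le> r"
  shows "continuous_on U (\<lambda>x. circle_mean r (g x))"
proof -
  have "continuous_on (U \<times> cbox (0::real) 1) (\<lambda>p. (\<lambda>(x, u). g x u) (fst p, circlepath 0 r (snd p)))"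
    by (rule continuous_on_compose2[OF assms(1)]) (use assms(2) in \<open>auto intro!: continuous_intros\<close>)
  then have "continuous_on (U \<times> cbox (0::real) 1) (\<lambda>(x, t). g x (circlepath 0 r t))"
    by (simp add: case_prod_beta)
  from integral_continuous_on_param[OF this] show ?thesis
    by (simp add: circle_mean_def)
qed

lemma holomorphic_on_circle_mean_param:
  assumes "\<And>x u. x \<in> U \<Longrightarrow> u \<in> sphere 0 r \<Longrightarrow> ((\<lambda>x. g x u) has_field_derivative g' x u) (at x within U)"
    and "\<And>x. x \<in> U \<Longrightarrow> continuous_on (sphere 0 r) (g x)"
    and "continuous_on (U \<times> sphere 0 r) (\<lambda>(x, u). g' x u)" "convex U" "0 \<le> r"
  shows "(\<lambda>x. circle_mean r (g x)) holomorphic_on U"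
proof -
  have "continuous_on (U \<times> cbox (0::real) 1) (\<lambda>p. (\<lambda>(x, u). g' x u) (fst p, circlepath 0 r (snd p)))"
    by (rule continuous_on_compose2[OF assms(3)]) (use assms(5) in \<open>auto intro!: continuous_intros\<close>)
  then have "continuous_on (U \<times> cbox (0::real) 1) (\<lambda>(x, t). g' x (circlepath 0 r t))"
    by (simp add: case_prod_beta)
  then have "(\<lambda>x. integral (cbox 0 1) (\<lambda>t. g x (circlepath 0 r t))) holomorphic_on U"
    using circle_integrable[OF assms(2) assms(5)] assms(1,4,5)
    by (intro leibniz_rule_holomorphic) auto
  then show ?thesis by (simp add: circle_mean_def)
qed

section \<open>The antilinear contraction\<close>

lemma disk_algebraD:
  assumes "f \<in> disk_algebra"
  shows "continuous_on (cball 0 1) f" "f holomorphic_on ball 0 1" "continuous_on (sphere 0 1) f"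
  using assms by (auto simp: disk_algebra_def elim: continuous_on_subset)

lemma disk_algebra_bdd:
  assumes "f \<in> disk_algebra"
  shows "bdd_above ((\<lambda>z. cmod (f z)) ` cball 0 1)"
  by (intro bounded_imp_bdd_above compact_imp_bounded compact_continuous_image continuous_intros
      disk_algebraD assms compact_cball)

lemma norm_le_supnorm:
  assumes "f \<in> disk_algebra" "z \<in> cball 0 1"
  shows "cmod (f z) \<le> supnorm f"
  unfolding supnorm_def by (rule cSUP_upper[OF assms(2) disk_algebra_bdd[OF assms(1)]])

lemma supnorm_le:
  assumes "\<And>z. z \<in> cball 0 1 \<Longrightarrow> cmod (f z) \<le> B"
  shows "supnorm f \<le> B"
  unfolding supnorm_def by (rule cSUP_least) (use assms in auto)

lemma supnorm_nonneg: "f \<in> disk_algebra \<Longrightarrow> 0 \<le> supnorm f"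
  using norm_le_supnorm[of f 0] norm_ge_zero[of "f 0"] by (simp del: norm_ge_zero)

text \<open>The radial retraction onto the closed disk. Composing with it makes the map below antilinear
  on the whole plane, not only on the disk.\<close>

definition clip :: "complex \<Rightarrow> complex" where
  "clip z = z / of_real (max 1 (norm z))"

lemma clip_mem: "clip z \<in> cball 0 1"
  by (simp add: clip_def norm_divide divide_simps)

lemma clip_id: "z \<in> cball 0 1 \<Longrightarrow> clip z = z"
  by (simp add: clip_def max_def)

text \<open>Conjugation inverts points of the unit circle, so the quotient and its conjugate add up
  to 1. This is the double layer potential of the circle itself, which is constant.\<close>

lemma Re_half:
  assumes "norm a = 1" "norm b = 1" "a \<noteq> b"
  shows "Re (a / (a - b)) = 1 / 2"
proof -
  have a: "a * cnj a = 1" "b * cnj b = 1"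
    using assms(1,2) by (simp_all flip: complex_norm_square)
  then have nz: "a \<noteq> 0" "b \<noteq> 0" by auto
  have c: "cnj a = 1 / a" "cnj b = 1 / b" using a nz by (simp_all add: field_simps)
  have "cnj (a / (a - b)) = (1 / a) / (1 / a - 1 / b)" by (simp add: c)
  also have "\<dots> = - b / (a - b)" using nz assms(3) by (simp add: field_simps)
  finally have "a / (a - b) + cnj (a / (a - b)) = (a - b) / (a - b)"
    by (simp only: add_divide_distrib[symmetric]) simp
  also have "\<dots> = 1" using assms(3) by simp
  finally have "2 * Re (a / (a - b)) = 1"
    by (metis complex_add_cnj of_real_eq_1_iff)
  then show ?thesis by simp
qed

context convex_chart
begin

text \<open>The Cauchy transform of the conjugate of f, pulled back to the disk. The singular part of its
  kernel integrates to the constant cnj (f 0), which is the mean of cnj f; this explains the 1.\<close>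

definition alpha :: "(complex \<Rightarrow> complex) \<Rightarrow> complex \<Rightarrow> complex" where
  "alpha f z = circle_mean 1 (\<lambda>u. cnj (f u) * (1 + hker u (clip z)))"

lemma sphere_subset: "sphere 0 1 \<subseteq> ball 0 s"
  using s_gt_1 by auto

lemma hker_sphere [continuous_intros]:
  "z \<in> ball 0 s \<Longrightarrow> continuous_on (sphere 0 1) (\<lambda>u. hker u z)"
  by (rule continuous_on_subset[OF hker_continuous1 sphere_subset])

text \<open>The integrand is holomorphic in the disk, and the factor \<open>\<zeta>\<close> in
  \<open>hker\<close> makes it vanish at the centre.\<close>

lemma circle_mean_hker:
  assumes "f \<in> disk_algebra" "z \<in> cball 0 1"
  shows "circle_mean 1 (\<lambda>u. f u * hker u z) = 0"
proof -
  have z: "z \<in> ball 0 s" using assms(2) cball_subset by blast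
  have "circle_mean 1 (\<lambda>u. f u * hker u z) = f 0 * hker 0 z"
    using disk_algebraD[OF assms(1)] s_gt_1
    by (intro circle_mean_holomorphic continuous_intros holomorphic_intros
        continuous_on_subset[OF hker_continuous1[OF z]] holomorphic_on_subset[OF hker_holomorphic1[OF z]]) auto
  then show ?thesis by simp
qed

text \<open>Inversion preserves the right half-plane, so \<open>Re_kernel_nonneg\<close> also
  controls the full Cauchy kernel. By \<open>Re_half\<close> its singular part accounts for exactly
  1/2, and twice the rest is at least -1.\<close>

lemma one_plus_hker_nonneg:
  assumes u: "norm u = 1" and z: "norm z = 1"
  shows "0 \<le> 1 + 2 * Re (hker u z)"
proof -
  have ub: "u \<in> ball 0 s" using u s_gt_1 by simp
  have off: "0 \<le> 1 + 2 * Re (hker u z)" if z: "norm z = 1" "u \<noteq> z" for z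
  proof -
    have zb: "z \<in> ball 0 s" using z s_gt_1 by simp
    have "0 \<le> Re ((\<phi> u - \<phi> z) / (u * deriv \<phi> u))"
      by (rule Re_kernel_nonneg[OF ub]) (use u z in auto)
    then have "0 \<le> Re (inverse ((\<phi> u - \<phi> z) / (u * deriv \<phi> u)))"
      by (simp only: inverse_complex.sel) (rule divide_nonneg_nonneg; simp)
    moreover have "Re (hker u z) = Re (inverse ((\<phi> u - \<phi> z) / (u * deriv \<phi> u))) - 1 / 2"
      using Re_half[OF u z] by (simp add: hker_off_diag[OF ub zb z(2)])
    ultimately show ?thesis by simp
  qed
  show ?thesis
  proof (cases "u = z")
    case True
    \<comment> \<open>The diagonal is a limit along the circle, since the value 1/2 is available
      only when both points lie on it.\<close>
    have "continuous_on UNIV (\<lambda>t. 1 + 2 * Re (hker u (u * cis t)))"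
      by (intro continuous_intros continuous_on_compose2[OF hker_continuous2[OF ub]])
         (use u s_gt_1 in \<open>auto simp: norm_mult\<close>)
    then have "((\<lambda>t. 1 + 2 * Re (hker u (u * cis t))) \<longlongrightarrow> 1 + 2 * Re (hker u (u * cis 0))) (at 0)"
      unfolding continuous_on_def by blast
    then have lim: "((\<lambda>t. 1 + 2 * Re (hker u (u * cis t))) \<longlongrightarrow> 1 + 2 * Re (hker u (u * cis 0))) (at_right 0)"
      by (rule tendsto_mono[rotated]) (simp add: at_le)
    have "eventually (\<lambda>t. t \<in> {0<..<1}) (at_right (0::real))"
      by (rule eventually_at_right_real) simp
    then have "eventually (\<lambda>t. 0 \<le> 1 + 2 * Re (hker u (u * cis t))) (at_right 0)"
    proof eventually_elim
      case (elim t)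
      have "sin t > 0" using elim pi_gt3 by (intro sin_gt_zero) auto
      then have "cis t \<noteq> 1" by (auto simp: complex_eq_iff)
      then have "u \<noteq> u * cis t" using u by auto
      then show ?case using u by (intro off) (auto simp: norm_mult)
    qed
    from tendsto_lowerbound[OF lim this] show ?thesis using True by simp
  qed (use off z in blast)
qed

text \<open>The conjugate kernel may be added freely because f times the kernel is holomorphic and vanishes
  at 0. The resulting weight is nonnegative on the unit circle.\<close>

lemma alpha_pos:
  assumes "f \<in> disk_algebra" "z \<in> cball 0 1"
  shows "alpha f z = circle_mean 1 (\<lambda>u. cnj (f u) * of_real (1 + 2 * Re (hker u z)))"
proof -
  have z: "z \<in> ball 0 s" using assms(2) cball_subset by blast
  have "circle_mean 1 (\<lambda>u. cnj (f u) * of_real (1 + 2 * Re (hker u z))) =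
      circle_mean 1 (\<lambda>u. cnj (f u) * (1 + hker u z) + cnj (f u * hker u z))"
    by (rule circle_mean_cong) (simp_all add: complex_eq_iff algebra_simps)
  also have "\<dots> = circle_mean 1 (\<lambda>u. cnj (f u) * (1 + hker u z)) + circle_mean 1 (\<lambda>u. cnj (f u * hker u z))"
    using disk_algebraD[OF assms(1)] z
    by (intro circle_mean_add continuous_intros) auto
  also have "circle_mean 1 (\<lambda>u. cnj (f u * hker u z)) = 0"
    by (simp only: circle_mean_cnj circle_mean_hker[OF assms]) simp
  finally show ?thesis by (simp add: alpha_def clip_id[OF assms(2)])
qed

text \<open>For the constant function 1, \<open>alpha_pos\<close> turns the real weight back into
  \<open>1 + hker u z\<close>, and \<open>hker\<close> has mean zero.\<close>

lemma circle_mean_weight: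
  assumes "z \<in> cball 0 1"
  shows "circle_mean 1 (\<lambda>u. of_real (1 + 2 * Re (hker u z))) = 1"
proof -
  have one: "(\<lambda>z. 1) \<in> disk_algebra" by (simp add: disk_algebra_def)
  have z: "z \<in> ball 0 s" using assms cball_subset by blast
  have "circle_mean 1 (\<lambda>u. of_real (1 + 2 * Re (hker u z))) = circle_mean 1 (\<lambda>u. 1 + hker u z)"
    using alpha_pos[OF one assms] by (simp add: alpha_def clip_id[OF assms])
  also have "\<dots> = 1 + circle_mean 1 (\<lambda>u. hker u z)"
    using circle_mean_add[of 1 "\<lambda>u. 1" "\<lambda>u. hker u z"] z by (simp add: continuous_intros)
  also have "circle_mean 1 (\<lambda>u. hker u z) = 0"
    using circle_mean_hker[OF one assms] by simp
  finally show ?thesis by simp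
qed

lemma alpha_one: "alpha (\<lambda>z. 1) = (\<lambda>z. 1)"
proof
  fix z
  have one: "(\<lambda>z. 1) \<in> disk_algebra" by (simp add: disk_algebra_def)
  have "alpha (\<lambda>z. 1) z = alpha (\<lambda>z. 1) (clip z)"
    by (simp add: alpha_def clip_id[OF clip_mem])
  also have "\<dots> = 1"
    using alpha_pos[OF one clip_mem] circle_mean_weight[OF clip_mem] by simp
  finally show "alpha (\<lambda>z. 1) z = 1" .
qed

lemma alpha_antilinear:
  assumes "f \<in> disk_algebra" "g \<in> disk_algebra"
  shows "alpha (\<lambda>z. c * f z + g z) = (\<lambda>z. cnj c * alpha f z + alpha g z)"
proof
  fix z
  have z: "clip z \<in> ball 0 s" using clip_mem cball_subset by blast
  have "alpha (\<lambda>z. c * f z + g z) z = circle_mean 1 (\<lambda>u. cnj c * (cnj (f u) * (1 + hker u (clip z))) +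
      cnj (g u) * (1 + hker u (clip z)))"
    unfolding alpha_def by (rule circle_mean_cong) (simp_all add: algebra_simps)
  also have "\<dots> = circle_mean 1 (\<lambda>u. cnj c * (cnj (f u) * (1 + hker u (clip z)))) + alpha g z"
    unfolding alpha_def using disk_algebraD[OF assms(1)] disk_algebraD[OF assms(2)] z
    by (intro circle_mean_add continuous_intros) auto
  also have "circle_mean 1 (\<lambda>u. cnj c * (cnj (f u) * (1 + hker u (clip z)))) = cnj c * alpha f z"
    unfolding alpha_def by (rule circle_mean_cmult)
  finally show "alpha (\<lambda>z. c * f z + g z) z = cnj c * alpha f z + alpha g z" .
qed

lemma \<phi>_diff_nz: "norm u = 1 \<Longrightarrow> norm z < 1 \<Longrightarrow> \<phi> u - \<phi> z \<noteq> 0"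
  using \<phi>_eq_iff[of u z] s_gt_1 by auto

lemma continuous_on_\<phi> [continuous_intros]:
  assumes "continuous_on S g" "\<And>x. x \<in> S \<Longrightarrow> g x \<in> ball 0 s"
  shows "continuous_on S (\<lambda>x. \<phi> (g x))" "continuous_on S (\<lambda>x. deriv \<phi> (g x))"
  using assms continuous_on_compose2[OF holomorphic_on_imp_continuous_on[OF hol_\<phi>]]
    continuous_on_compose2[OF holomorphic_on_imp_continuous_on[OF hol_deriv]] by blast+

text \<open>The summand 1 in the kernel of \<open>alpha\<close> contributes the mean of
  \<open>cnj (f u)\<close>, which is also its integral against \<open>u / (u - z)\<close>.
  Exchanging the two restores the full Cauchy kernel of the curve.\<close>

lemma alpha_kernel:
  assumes "f \<in> disk_algebra" "norm z < 1"
  shows "alpha f z = circle_mean 1 (\<lambda>u. cnj (f u) * (u * deriv \<phi> u / (\<phi> u - \<phi> z)))"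
proof -
  have z: "z \<in> ball 0 s" using assms(2) s_gt_1 by simp
  note f = disk_algebraD[OF assms(1)]
  have m: "circle_mean 1 (\<lambda>u. cnj (f u)) = cnj (f 0)"
  proof -
    have "circle_mean 1 (\<lambda>u. cnj (f u)) = circle_mean 1 (\<lambda>u. cnj (f u) * (u / (u - 0)))"
      by (rule circle_mean_cong) auto
    then show ?thesis using circle_mean_cnj_Cauchy[OF f(1,2), of 0] by simp
  qed
  have "alpha f z = circle_mean 1 (\<lambda>u. cnj (f u) + cnj (f u) * hker u z)"
    unfolding alpha_def using assms(2) by (intro circle_mean_cong) (auto simp: clip_id algebra_simps)
  also have "\<dots> = circle_mean 1 (\<lambda>u. cnj (f u)) + circle_mean 1 (\<lambda>u. cnj (f u) * hker u z)"
    using f z by (intro circle_mean_add continuous_intros) auto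
  also have "\<dots> = circle_mean 1 (\<lambda>u. cnj (f u) * hker u z) + circle_mean 1 (\<lambda>u. cnj (f u) * (u / (u - z)))"
    using circle_mean_cnj_Cauchy[OF f(1,2) assms(2)] m by simp
  also have "\<dots> = circle_mean 1 (\<lambda>u. cnj (f u) * hker u z + cnj (f u) * (u / (u - z)))"
    using f z assms(2) by (intro circle_mean_add[symmetric] continuous_intros) auto
  also have "\<dots> = circle_mean 1 (\<lambda>u. cnj (f u) * (u * deriv \<phi> u / (\<phi> u - \<phi> z)))"
  proof (rule circle_mean_cong)
    fix u :: complex assume "u \<in> sphere 0 1"
    then have "u \<in> ball 0 s" "u \<noteq> z" using s_gt_1 assms(2) by auto
    then show "cnj (f u) * hker u z + cnj (f u) * (u / (u - z)) =
        cnj (f u) * (u * deriv \<phi> u / (\<phi> u - \<phi> z))"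
      by (simp add: hker_off_diag[OF _ z] right_diff_distrib)
  qed simp
  finally show ?thesis .
qed

text \<open>Two formulas share the work: the one with \<open>hker\<close> is continuous up to the
  boundary, the Cauchy kernel is visibly holomorphic in \<open>z\<close> inside.\<close>

lemma alpha_mem:
  assumes "f \<in> disk_algebra"
  shows "alpha f \<in> disk_algebra"
proof -
  note f = disk_algebraD[OF assms]
  have fs: "continuous_on S (\<lambda>x. f (g x))" if "continuous_on S g" "\<And>x. x \<in> S \<Longrightarrow> norm (g x) = 1"
    for S :: "(complex \<times> complex) set" and g
    by (rule continuous_on_compose2[OF f(3) that(1)]) (use that(2) in auto)
  have "continuous_on (cball 0 1 \<times> sphere 0 1) (\<lambda>p. (\<lambda>(u, z). hker u z) (snd p, fst p))"
    by (rule continuous_on_compose2[OF hker_continuous])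
       (use cball_subset sphere_subset in \<open>auto intro!: continuous_intros\<close>)
  then have "continuous_on (cball 0 1 \<times> sphere 0 1) (\<lambda>(z, u). cnj (f u) * (1 + hker u z))"
    unfolding case_prod_beta by (intro continuous_intros fs) auto
  then have "continuous_on (cball 0 1) (\<lambda>z. circle_mean 1 (\<lambda>u. cnj (f u) * (1 + hker u z)))"
    by (rule continuous_on_circle_mean_param) simp
  then have 1: "continuous_on (cball 0 1) (alpha f)"
    by (rule continuous_on_eq) (simp add: alpha_def clip_id)
  have "(\<lambda>z. circle_mean 1 (\<lambda>u. cnj (f u) * (u * deriv \<phi> u / (\<phi> u - \<phi> z)))) holomorphic_on ball 0 1"
  proof (rule holomorphic_on_circle_mean_param)
    fix z u :: complex assume zu: "z \<in> ball 0 1" "u \<in> sphere 0 1"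
    then have "z \<in> ball 0 s" using s_gt_1 by simp
    note d = has_field_derivative_at_within[OF \<phi>_has_deriv[OF this]]
    show "((\<lambda>z. cnj (f u) * (u * deriv \<phi> u / (\<phi> u - \<phi> z))) has_field_derivative
        cnj (f u) * (u * deriv \<phi> u * deriv \<phi> z / (\<phi> u - \<phi> z)\<^sup>2)) (at z within ball 0 1)"
      using \<phi>_diff_nz[of u z] zu by (auto intro!: derivative_eq_intros d simp: power2_eq_square)
  next
    fix z :: complex assume z: "z \<in> ball 0 1"
    show "continuous_on (sphere 0 1) (\<lambda>u. cnj (f u) * (u * deriv \<phi> u / (\<phi> u - \<phi> z)))"
      by (intro continuous_intros f) (use \<phi>_diff_nz z s_gt_1 in auto)
  next
    show "continuous_on (ball 0 1 \<times> sphere 0 1)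
        (\<lambda>(z, u). cnj (f u) * (u * deriv \<phi> u * deriv \<phi> z / (\<phi> u - \<phi> z)\<^sup>2))"
      unfolding case_prod_beta
      by (intro continuous_intros fs) (use \<phi>_diff_nz s_gt_1 in auto)
  qed auto
  then have "alpha f holomorphic_on ball 0 1"
    by (rule holomorphic_transform) (simp add: alpha_kernel[OF assms])
  with 1 show ?thesis by (simp add: disk_algebra_def)
qed

text \<open>The weight is known to be nonnegative only for \<open>z\<close> on the circle. There
  \<open>alpha f z\<close> is an average of \<open>cnj (f u)\<close>; the maximum modulus principle
  covers the interior.\<close>

lemma alpha_contraction:
  assumes "f \<in> disk_algebra"
  shows "supnorm (alpha f) \<le> supnorm f"
proof (rule supnorm_le)
  fix z :: complex assume z: "z \<in> cball 0 1"
  note a = disk_algebraD[OF alpha_mem[OF assms]]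
  show "cmod (alpha f z) \<le> supnorm f"
  proof (rule maximum_modulus_frontier[where S = "cball 0 1" and f = "alpha f"])
    fix z :: complex assume "z \<in> frontier (cball 0 1)"
    then have nz: "norm z = 1" and z: "z \<in> cball 0 1" by auto
    then have zs: "z \<in> ball 0 s" using s_gt_1 by simp
    have "cmod (alpha f z) \<le> Re (circle_mean 1 (\<lambda>u. of_real (supnorm f) * of_real (1 + 2 * Re (hker u z))))"
      unfolding alpha_pos[OF assms z]
    proof (rule circle_mean_norm_le)
      fix u :: complex assume "u \<in> sphere 0 1"
      then have u: "norm u = 1" "u \<in> cball 0 1" by auto
      have "cmod (f u) * (1 + 2 * Re (hker u z)) \<le> supnorm f * (1 + 2 * Re (hker u z))"
        by (intro mult_right_mono norm_le_supnorm assms u one_plus_hker_nonneg nz)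
      then show "cmod (cnj (f u) * of_real (1 + 2 * Re (hker u z))) \<le>
          Re (of_real (supnorm f) * of_real (1 + 2 * Re (hker u z)))"
        using one_plus_hker_nonneg[OF u(1) nz]
        by (simp only: norm_mult complex_mod_cnj norm_of_real abs_of_nonneg of_real_mult[symmetric] Re_complex_of_real)
    qed (use disk_algebraD[OF assms] zs in \<open>auto intro!: continuous_intros\<close>)
    also have "\<dots> = supnorm f"
      by (simp only: circle_mean_cmult circle_mean_weight[OF z]) simp
    finally show "cmod (alpha f z) \<le> supnorm f" .
  qed (use a z in auto)
qed

lemma alpha_unital_antilinear_contraction: "unital_antilinear_contraction alpha"
  unfolding unital_antilinear_contraction_def
  using alpha_mem alpha_antilinear alpha_contraction alpha_one by blast

end

section \<open>The functional calculus\<close>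

lemma cinner_adjoint_right: "cinner (A *v x) y = cinner x (adjoint_mat A *v y)"
  using cinner_adjoint[of A y x] by (metis cinner_commute)

lemma cinner_self_eq_0: "cinner x x = 0 \<Longrightarrow> x = 0"
  by (metis norm_cinner of_real_eq_0_iff power_eq_0_iff norm_eq_zero)

lemma matrix_eq_cinnerI:
  fixes A B :: "complex^'n^'n"
  assumes "\<And>x y. cinner (A *v x) y = cinner (B *v x) y"
  shows "A = B"
proof -
  have "A *v x = B *v x" for x
  proof -
    have "cinner (A *v x - B *v x) (A *v x - B *v x) = 0"
      by (simp add: cinner_diff_left assms)
    then show ?thesis using cinner_self_eq_0 by fastforce
  qed
  then show ?thesis by (simp add: matrix_eq)
qed

text \<open>The Newton form, the sum over k of (T - l_1) ... (T - l_{k-1}) / ((w - l_1) ... (w - l_k)), of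
  the inverse of w - T for a matrix annihilated by the product of all T - l_i.\<close>

fun newton_resolvent :: "complex^'n^'n \<Rightarrow> complex list \<Rightarrow> complex \<Rightarrow> complex^'n^'n" where
  "newton_resolvent T [] w = 0"
| "newton_resolvent T (l # ls) w =
     mscale (1 / (w - l)) (mat 1 + newton_resolvent T ls w ** (T - mscale l (mat 1)))"

lemma newton_resolvent_Cons_vector:
  "newton_resolvent T (l # ls) w *v x =
     (1 / (w - l)) *s (x + newton_resolvent T ls w *v (T *v x - l *s x))"
  by (simp add: mscale_vector matrix_vector_mult_add_rdistrib matrix_vector_mult_diff_rdistrib
      flip: matrix_vector_mul_assoc)

text \<open>The sum telescopes: peeling off \<open>l\<close> replaces \<open>x\<close> by
  \<open>T *v x - l *s x\<close>, which is why the induction generalises over \<open>x\<close>. The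
  error is the annihilating product, so it vanishes in the application.\<close>

lemma newton_resolvent_identity:
  fixes T :: "complex^'n^'n"
  assumes "w \<notin> set ls"
  shows "w *s (newton_resolvent T ls w *v x) - T *v (newton_resolvent T ls w *v x) =
    x - (1 / (\<Prod>l\<leftarrow>ls. w - l)) *s (poly_mat (\<Prod>l\<leftarrow>ls. [:- l, 1:]) T *v x)"
  using assms
proof (induction ls arbitrary: x)
  case Nil
  have "poly_mat 1 T = mat 1" by (simp add: poly_mat_def)
  then show ?case by simp
next
  case (Cons l ls)
  define y where "y = T *v x - l *s x"
  define R where "R = newton_resolvent T ls w"
  define P where "P = poly_mat (\<Prod>l\<leftarrow>ls. [:- l, 1:]) T"
  define c where "c = (\<Prod>l\<leftarrow>ls. w - l)"
  have wl: "w - l \<noteq> 0" using Cons.prems by auto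
  have IH: "w *s (R *v y) - T *v (R *v y) = y - (1 / c) *s (P *v y)"
    using Cons by (simp add: R_def P_def c_def)
  have "poly_mat (\<Prod>l\<leftarrow>l # ls. [:- l, 1:]) T = P ** (T - mscale l (mat 1))"
    by (simp add: P_def mult.commute[of "[:- l, 1:]"] poly_mat_mult poly_mat_linear_factor del: mult_pCons_left mult_pCons_right)
  then have P': "poly_mat (\<Prod>l\<leftarrow>l # ls. [:- l, 1:]) T *v x = P *v y"
    by (simp add: y_def matrix_vector_mult_diff_rdistrib mscale_vector flip: matrix_vector_mul_assoc)
  have "w *s (newton_resolvent T (l # ls) w *v x) - T *v (newton_resolvent T (l # ls) w *v x)
      = (1 / (w - l)) *s (w *s x - T *v x + (w *s (R *v y) - T *v (R *v y)))"
    unfolding newton_resolvent_Cons_vector R_def[symmetric] y_def[symmetric]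
    by (simp add: vector_scalar_commute matrix_vector_right_distrib vec_eq_iff algebra_simps)
  also have "\<dots> = (1 / (w - l)) *s ((w - l) *s x - (1 / c) *s (P *v y))"
    unfolding IH by (simp add: y_def vec_eq_iff algebra_simps)
  also have "\<dots> = x - (1 / ((w - l) * c)) *s (P *v y)"
  proof -
    have "(1 / (w - l)) *s ((w - l) *s x - v) = x - (1 / (w - l)) *s v" for v
      using wl by (simp only: vector_ssub_ldistrib vector_smult_assoc) simp
    then show ?thesis by (simp add: vector_smult_assoc)
  qed
  finally show ?case unfolding P' by (simp add: c_def)
qed

lemma continuous_on_mscale [continuous_intros]:
  fixes A :: "'a::topological_space \<Rightarrow> complex^'n^'n"
  assumes "continuous_on S c" "continuous_on S A"
  shows "continuous_on S (\<lambda>z. mscale (c z) (A z))"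
  unfolding mscale_def using assms by (intro continuous_intros)

lemma continuous_on_matrix_mult [continuous_intros]:
  fixes A B :: "'a::topological_space \<Rightarrow> complex^'n^'n"
  assumes "continuous_on S A" "continuous_on S B"
  shows "continuous_on S (\<lambda>z. A z ** B z)"
  unfolding matrix_matrix_mult_def using assms by (intro continuous_intros)

lemma continuous_on_newton_resolvent [continuous_intros]:
  assumes "continuous_on S g" "\<And>z. z \<in> S \<Longrightarrow> g z \<notin> set ls"
  shows "continuous_on S (\<lambda>z. newton_resolvent T ls (g z))"
  using assms by (induction ls) (auto intro!: continuous_intros)

text \<open>Radii below 1 occur because the functional calculus is also evaluated on smaller
  circles.\<close>

definition disk_alg :: "real \<Rightarrow> (complex \<Rightarrow> complex) set" where
  "disk_alg r = {f. continuous_on (cball 0 r) f \<and> f holomorphic_on ball 0 r}"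

lemma disk_alg_1: "disk_alg 1 = disk_algebra"
  by (simp add: disk_alg_def disk_algebra_def)

lemma disk_alg_intros:
  "(\<lambda>z. c) \<in> disk_alg r"
  "f \<in> disk_alg r \<Longrightarrow> g \<in> disk_alg r \<Longrightarrow> (\<lambda>z. f z + g z) \<in> disk_alg r"
  "f \<in> disk_alg r \<Longrightarrow> g \<in> disk_alg r \<Longrightarrow> (\<lambda>z. f z * g z) \<in> disk_alg r"
  by (auto simp: disk_alg_def intro: continuous_intros holomorphic_intros)

lemma disk_alg_poly: "f \<in> disk_alg r \<Longrightarrow> (\<lambda>z. poly p (f z)) \<in> disk_alg r"
  by (induction p) (auto intro: disk_alg_intros)

lemma disk_alg_subset: "r \<le> r' \<Longrightarrow> disk_alg r' \<subseteq> disk_alg r"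
  by (auto simp: disk_alg_def elim!: continuous_on_subset holomorphic_on_subset)

lemma disk_alg_sphere: "f \<in> disk_alg r \<Longrightarrow> continuous_on (sphere 0 r) f"
  by (auto simp: disk_alg_def elim: continuous_on_subset)

lemma disk_alg_difference_quotient:
  assumes f: "f \<in> disk_alg r" and z: "norm z < r"
  obtains g where "g \<in> disk_alg r" "\<And>u. f u = f z + (u - z) * g u"
proof -
  define g where "g u = (if u = z then deriv f z else (f u - f z) / (u - z))" for u
  have fc: "continuous_on (cball 0 r) f" and fh: "f holomorphic_on ball 0 r"
    using f by (auto simp: disk_alg_def)
  have hol: "g holomorphic_on ball 0 r"
    unfolding g_def[abs_def] by (rule pole_lemma_open[OF fh open_ball])
  have "continuous_on (cball 0 r - {z}) (\<lambda>u. (f u - f z) / (u - z))"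
    by (intro continuous_intros continuous_on_subset[OF fc]) auto
  then have c: "continuous_on (cball 0 r - {z}) g"
    by (rule continuous_on_eq) (simp add: g_def)
  have "continuous (at u within cball 0 r) g" if u: "u \<in> cball 0 r" for u
  proof (cases "u = z")
    case True
    then have "isCont g u"
      using hol z by (metis continuous_on_eq_continuous_at holomorphic_on_imp_continuous_on mem_ball_0 open_ball)
    then show ?thesis by (rule continuous_at_imp_continuous_at_within)
  next
    case False
    then have "continuous (at u within (cball 0 r - {z})) g"
      using c u by (simp add: continuous_on_eq_continuous_within)
    moreover have "at u within (cball 0 r - {z}) = at u within (cball 0 r \<inter> - {z})"
      by (simp add: Diff_eq)
    moreover have "\<dots> = at u within cball 0 r"
      using False by (intro at_within_nhd[of u "- {z}"]) auto
    ultimately show ?thesis by simp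
  qed
  then have "g \<in> disk_alg r"
    using hol by (simp add: disk_alg_def continuous_on_eq_continuous_within)
  moreover have "f u = f z + (u - z) * g u" for u by (simp add: g_def)
  ultimately show ?thesis using that by blast
qed

lemma partial_fraction_two:
  fixes p q m x :: complex
  assumes "p \<noteq> 0" "q \<noteq> 0" "m \<noteq> 0"
  shows "x / (p * m) - x / (q * m) = (q - p) * (x / (p * (q * m)))"
proof -
  have "q * (x / (p * (q * m))) = x / (p * m)" "p * (x / (p * (q * m))) = x / (q * m)"
    using assms by simp_all
  then show ?thesis by (simp only: left_diff_distrib)
qed

section \<open>Residue integrals along the image of a circle\<close>

context convex_chart
begin

lemma \<phi>_disk_alg: "r < s \<Longrightarrow> \<phi> \<in> disk_alg r"
  by (auto simp: disk_alg_def intro: holomorphic_on_subset[OF hol_\<phi>]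
      continuous_on_subset[OF holomorphic_on_imp_continuous_on[OF hol_\<phi>]])

lemma deriv_\<phi>_disk_alg: "r < s \<Longrightarrow> (\<lambda>u. u * deriv \<phi> u) \<in> disk_alg r"
  by (auto simp: disk_alg_def intro!: holomorphic_intros continuous_intros
      holomorphic_on_subset[OF hol_deriv]
      continuous_on_subset[OF holomorphic_on_imp_continuous_on[OF hol_deriv]])

lemma \<phi>_sphere_notin:
  assumes "u \<in> sphere 0 r" "r < s" "l \<in> \<phi> ` ball 0 r"
  shows "\<phi> u \<noteq> l"
proof -
  obtain z where "l = \<phi> z" "norm z < r" using assms(3) by auto
  then show ?thesis using assms(1,2) \<phi>_eq_iff[of u z] by auto
qed

text \<open>The argument principle for a value taken once: \<open>hker\<close> has mean zero, and
  \<open>u / (u - z)\<close> is the Cauchy kernel acting on the constant 1.\<close>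

lemma circle_mean_inverse_linear:
  assumes "0 < r" "r < s" "l \<in> \<phi> ` ball 0 r"
  shows "circle_mean r (\<lambda>u. u * deriv \<phi> u / (\<phi> u - l)) = 1"
proof -
  obtain z where z: "l = \<phi> z" "norm z < r" using assms(3) by auto
  then have zs: "z \<in> ball 0 s" using assms(2) by simp
  have "circle_mean r (\<lambda>u. u * deriv \<phi> u / (\<phi> u - l)) = circle_mean r (\<lambda>u. hker u z + 1 * (u / (u - z)))"
  proof (rule circle_mean_cong)
    fix u :: complex assume "u \<in> sphere 0 r"
    then have "u \<in> ball 0 s" "u \<noteq> z" using assms(2) z(2) by auto
    then show "u * deriv \<phi> u / (\<phi> u - l) = hker u z + 1 * (u / (u - z))"
      by (simp add: hker_off_diag[OF _ zs] z(1))
  qed (use assms in simp)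
  also have "\<dots> = circle_mean r (\<lambda>u. hker u z) + circle_mean r (\<lambda>u. 1 * (u / (u - z)))"
    using assms z by (intro circle_mean_add continuous_intros continuous_on_subset[OF hker_continuous1[OF zs]]) auto
  also have "circle_mean r (\<lambda>u. hker u z) = hker 0 z"
    using assms by (intro circle_mean_holomorphic continuous_on_subset[OF hker_continuous1[OF zs]]
        holomorphic_on_subset[OF hker_holomorphic1[OF zs]]) auto
  also have "circle_mean r (\<lambda>u. 1 * (u / (u - z))) = 1"
    using z by (intro circle_mean_Cauchy) auto
  finally show ?thesis by simp
qed

text \<open>Distinct factors are separated by partial fractions; a pure power has a primitive.\<close>

lemma circle_mean_inverse_prod:
  assumes "0 < r" "r < s" "set_mset A \<subseteq> \<phi> ` ball 0 r" "2 \<le> size A"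
  shows "circle_mean r (\<lambda>u. u * deriv \<phi> u / (\<Prod>l\<in>#A. \<phi> u - l)) = 0"
  using assms(3,4)
proof (induction "size A" arbitrary: A rule: less_induct)
  case less
  have nz: "\<phi> u - l \<noteq> 0" if "u \<in> sphere 0 r" "l \<in># A" for u l
    using \<phi>_sphere_notin[OF that(1) assms(2), of l] that(2) less.prems by auto
  obtain a N where A: "A = add_mset a N" using less.prems(2) by (cases A) auto
  show ?case
  proof (cases "set_mset N \<subseteq> {a}")
    case True
    then have N: "N = replicate_mset (size N) a" by (rule set_mset_subset_singletonD)
    obtain k where k: "size N = Suc k" using less.prems(2) A by (cases "size N") auto
    \<comment> \<open>The denominator is the power \<open>k + 2\<close> of a single factor; an
      exponent of at least 2 is what provides this primitive.\<close>
    define F where "F u = - (inverse (\<phi> u - a) ^ Suc k) / of_nat (Suc k)" for u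
    have "circle_mean r (\<lambda>u. u * (deriv \<phi> u * inverse (\<phi> u - a) ^ Suc (Suc k))) = 0"
    proof (rule circle_mean_primitive[OF _ assms(1), where F = F])
      fix u :: complex assume u: "u \<in> sphere 0 r"
      then have "u \<in> ball 0 s" using assms(2) by auto
      note d = \<phi>_has_deriv[OF this]
      have n: "\<phi> u - a \<noteq> 0" using nz[OF u] A by simp
      show "(F has_field_derivative deriv \<phi> u * inverse (\<phi> u - a) ^ Suc (Suc k)) (at u)"
      proof -
        have i: "((\<lambda>u. inverse (\<phi> u - a)) has_field_derivative
            - (inverse (\<phi> u - a) * deriv \<phi> u * inverse (\<phi> u - a))) (at u)"
          by (rule DERIV_inverse'[where f = "\<lambda>u. \<phi> u - a", OF _ n]) (auto intro!: derivative_eq_intros d)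
        have "(F has_field_derivative - (of_nat (Suc k) * (- (inverse (\<phi> u - a) * deriv \<phi> u * inverse (\<phi> u - a)) *
            inverse (\<phi> u - a) ^ k)) / of_nat (Suc k)) (at u)"
          unfolding F_def using DERIV_power_Suc[OF i, of k]
          by (intro DERIV_cdivide DERIV_minus) (simp add: algebra_simps)
        then show ?thesis by (simp del: of_nat_Suc add: mult_ac)
      qed
    qed
    moreover have "u * deriv \<phi> u / (\<Prod>l\<in>#A. \<phi> u - l) = u * (deriv \<phi> u * inverse (\<phi> u - a) ^ Suc (Suc k))" for u
      unfolding A by (subst N) (simp add: k divide_inverse power_inverse mult.assoc)
    ultimately show ?thesis by simp
  next
    case False
    then obtain b M where b: "b \<noteq> a" "N = add_mset b M" by (metis insert_DiffM singletonI subsetI)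
    have mem: "a \<in> \<phi> ` ball 0 r" "b \<in> \<phi> ` ball 0 r" "set_mset M \<subseteq> \<phi> ` ball 0 r"
      using less.prems(1) A b by auto
    define f where "f c u = u * deriv \<phi> u / (\<Prod>l\<in>#add_mset c M. \<phi> u - l)" for c u
    \<comment> \<open>Both means are 1 if \<open>M\<close> is empty, and both are 0 by induction
      otherwise. In either case they cancel in the partial fraction decomposition.\<close>
    have eq: "circle_mean r (f a) = circle_mean r (f b)"
    proof (cases "M = {#}")
      case True
      then show ?thesis
        using circle_mean_inverse_linear[OF assms(1,2) mem(1)] circle_mean_inverse_linear[OF assms(1,2) mem(2)]
        by (simp add: f_def[abs_def])
    next
      case False
      then have sz: "2 \<le> size (add_mset c M)" for c by (cases M) auto
      have "circle_mean r (f c) = 0" if "c \<in> {a, b}" for c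
        unfolding f_def[abs_def] by (rule less.hyps) (use that mem sz A b in auto)
      then show ?thesis by simp
    qed
    have prodM: "(\<Prod>l\<in>#M. \<phi> u - l) \<noteq> 0" if "u \<in> sphere 0 r" for u
      using nz[OF that] A b by (auto simp: prod_mset_zero_iff)
    have cont: "continuous_on (sphere 0 r) (f c)" if "c \<in> {a, b}" for c
    proof -
      have "continuous_on (sphere 0 r) (\<lambda>u. \<Prod>l\<in>#X. \<phi> u - l)" for X
        using assms(2) by (induction X) (auto intro!: continuous_intros)
      from this[of "add_mset c M"] show ?thesis
        unfolding f_def[abs_def]
      proof (rule continuous_on_divide[rotated])
        show "continuous_on (sphere 0 r) (\<lambda>u. u * deriv \<phi> u)"
          using assms(2) by (intro continuous_intros) auto
        show "\<forall>u\<in>sphere 0 r. (\<Prod>l\<in>#add_mset c M. \<phi> u - l) \<noteq> 0"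
        proof
          fix u :: complex assume u: "u \<in> sphere 0 r"
          have "\<phi> u - c \<noteq> 0" using nz[OF u, of c] that A b by auto
          then show "(\<Prod>l\<in>#add_mset c M. \<phi> u - l) \<noteq> 0" using prodM[OF u] by simp
        qed
      qed
    qed
    have "circle_mean r (\<lambda>u. u * deriv \<phi> u / (\<Prod>l\<in>#A. \<phi> u - l)) =
        circle_mean r (\<lambda>u. (1 / (a - b)) * (f a u + (-1) * f b u))"
    proof (rule circle_mean_cong)
      fix u :: complex assume u: "u \<in> sphere 0 r"
      have "\<phi> u - a \<noteq> 0" "\<phi> u - b \<noteq> 0" "a - b \<noteq> 0" using nz[OF u] A b by auto
      note pf = partial_fraction_two[OF this(1,2), of "\<Prod>l\<in>#M. \<phi> u - l" "u * deriv \<phi> u"]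
      have "f a u + (-1) * f b u = (a - b) * (u * deriv \<phi> u / (\<Prod>l\<in>#A. \<phi> u - l))"
        using pf prodM[OF u] by (simp add: f_def A b)
      then show "u * deriv \<phi> u / (\<Prod>l\<in>#A. \<phi> u - l) = (1 / (a - b)) * (f a u + (-1) * f b u)"
        using \<open>a - b \<noteq> 0\<close> by simp
    qed (use assms in simp)
    also have "\<dots> = (1 / (a - b)) * (circle_mean r (f a) + (-1) * circle_mean r (f b))"
      using cont assms(1) by (subst circle_mean_cmult, subst circle_mean_add)
        (auto intro!: continuous_intros simp: circle_mean_cmult[of _ "-1", simplified])
    also have "\<dots> = 0" using eq by simp
    finally show ?thesis .
  qed
qed

end

text \<open>With a factored annihilating polynomial the resolvent of \<open>T\<close> becomes a
  rational function with poles in \<open>ls\<close>. These poles, like the whole numerical range,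
  lie inside the image of the unit circle.\<close>

locale chart_matrix = convex_chart +
  fixes T :: "complex^'n^'n" and ls :: "complex list"
  assumes annihilated: "poly_mat (\<Prod>l\<leftarrow>ls. [:- l, 1:]) T = 0"
    and ls_range: "set ls \<subseteq> numerical_range T"
    and W_subset: "numerical_range T \<subseteq> \<phi> ` ball 0 1"
begin

text \<open>The circle of radius \<open>r\<close> has to enclose the poles in \<open>ls\<close>
  only, not the numerical range. As there are finitely many poles, some radius below 1
  qualifies.\<close>

definition admissible :: "real \<Rightarrow> bool" where
  "admissible r \<longleftrightarrow> 0 < r \<and> r \<le> 1 \<and> set ls \<subseteq> \<phi> ` ball 0 r"

lemma admissible_1: "admissible 1"
  using ls_range W_subset by (auto simp: admissible_def)

lemma admissibleD:
  assumes "admissible r"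
  shows "0 < r" "0 \<le> r" "r < s" "r \<le> 1" "set ls \<subseteq> \<phi> ` ball 0 r"
  using assms s_gt_1 by (auto simp: admissible_def)

lemma admissible_less_1: "\<exists>r<1. admissible r"
proof -
  have "\<exists>r. 0 < r \<and> r < 1 \<and> set xs \<subseteq> \<phi> ` ball 0 r" if "set xs \<subseteq> \<phi> ` ball 0 1" for xs
    using that
  proof (induction xs)
    case Nil
    then show ?case by (auto intro: exI[of _ "1/2"])
  next
    case (Cons a xs)
    then obtain r where r: "0 < r" "r < 1" "set xs \<subseteq> \<phi> ` ball 0 r" by auto
    obtain z where z: "a = \<phi> z" "norm z < 1" using Cons.prems by auto
    obtain q where q: "max r (norm z) < q" "q < 1" using r z dense[of "max r (norm z)" 1] by auto
    have "ball 0 r \<subseteq> ball (0::complex) q" using q by auto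
    then have "set (a # xs) \<subseteq> \<phi> ` ball 0 q" using r z q by auto
    then show ?case using q r by (intro exI[of _ q]) auto
  qed
  moreover have "set ls \<subseteq> \<phi> ` ball 0 1" using ls_range W_subset by blast
  ultimately obtain r where "0 < r" "r < 1" "set ls \<subseteq> \<phi> ` ball 0 r" by blast
  then have "admissible r" by (simp add: admissible_def)
  then show ?thesis using \<open>r < 1\<close> by blast
qed

definition R :: "complex \<Rightarrow> complex^'n^'n" where
  "R u = newton_resolvent T ls (\<phi> u)"

text \<open>With \<open>w = \<phi> u\<close>, the Cauchy integral of the resolvent of
  \<open>T\<close>, with its factor \<open>1 / (2 * pi * \<i>)\<close>, becomes a circle mean
  against this kernel.\<close>

definition K :: "complex \<Rightarrow> complex^'n^'n" where
  "K u = mscale (u * deriv \<phi> u) (R u)"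

lemma \<phi>_notin_ls:
  assumes "admissible r" "u \<in> sphere 0 r"
  shows "\<phi> u \<notin> set ls"
proof
  assume "\<phi> u \<in> set ls"
  then have "\<phi> u \<in> \<phi> ` ball 0 r" using admissibleD(5)[OF assms(1)] by (rule subsetD[rotated])
  then show False using \<phi>_sphere_notin[OF assms(2) admissibleD(3)[OF assms(1)]] by blast
qed

lemma R_right: "admissible r \<Longrightarrow> u \<in> sphere 0 r \<Longrightarrow> \<phi> u *s (R u *v x) - T *v (R u *v x) = x"
  using newton_resolvent_identity[OF \<phi>_notin_ls, of r u T x] annihilated by (simp add: R_def)

lemma R_left:
  assumes "admissible r" "u \<in> sphere 0 r"
  shows "R u ** (mscale (\<phi> u) (mat 1) - T) = mat 1"
proof -
  have "(mscale (\<phi> u) (mat 1) - T) ** R u = mat 1"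
    using R_right[OF assms]
    by (simp add: matrix_eq matrix_vector_mult_diff_rdistrib mscale_vector flip: matrix_vector_mul_assoc)
  then show ?thesis by (simp add: matrix_left_right_inverse)
qed

lemma K_right:
  assumes "admissible r" "u \<in> sphere 0 r"
  shows "\<phi> u *s (K u *v x) - T *v (K u *v x) = (u * deriv \<phi> u) *s x"
proof -
  have "\<phi> u *s (K u *v x) - T *v (K u *v x) = (u * deriv \<phi> u) *s (\<phi> u *s (R u *v x) - T *v (R u *v x))"
    by (simp add: K_def mscale_vector vector_scalar_commute vector_ssub_ldistrib vector_smult_assoc mult.commute)
  then show ?thesis by (simp add: R_right[OF assms])
qed

lemma K_continuous:
  assumes "admissible r"
  shows "continuous_on (sphere 0 r) K"
  unfolding K_def[abs_def] R_def
  by (intro continuous_intros) (use \<phi>_notin_ls[OF assms] admissibleD[OF assms] in auto)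

text \<open>For f on the disk this is the value at T of the composition of f with the inverse chart, as a
  Cauchy integral over the image of a circle.\<close>

definition calc :: "real \<Rightarrow> (complex \<Rightarrow> complex) \<Rightarrow> complex^'n^'n" where
  "calc r f = (\<chi> i j. circle_mean r (\<lambda>u. f u * K u $ i $ j))"

lemma calc_cinner:
  assumes "admissible r" "continuous_on (sphere 0 r) f"
  shows "cinner (calc r f *v x) y = circle_mean r (\<lambda>u. f u * cinner (K u *v x) y)"
proof -
  note c = continuous_intros assms(2) K_continuous[OF assms(1)]
  note r = admissibleD[OF assms(1)]
  have "cinner (calc r f *v x) y =
      (\<Sum>i\<in>UNIV. \<Sum>j\<in>UNIV. (x $ j * cnj (y $ i)) * circle_mean r (\<lambda>u. f u * K u $ i $ j))"
    by (simp add: cinner_def matrix_vector_mult_def calc_def sum_distrib_left algebra_simps)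
  also have "\<dots> = (\<Sum>i\<in>UNIV. circle_mean r (\<lambda>u. \<Sum>j\<in>UNIV. (x $ j * cnj (y $ i)) * (f u * K u $ i $ j)))"
    unfolding circle_mean_cmult[symmetric]
    by (intro sum.cong refl circle_mean_sum[symmetric] c) (use r in auto)
  also have "\<dots> = circle_mean r (\<lambda>u. \<Sum>i\<in>UNIV. \<Sum>j\<in>UNIV. (x $ j * cnj (y $ i)) * (f u * K u $ i $ j))"
    by (intro circle_mean_sum[symmetric] c) (use r in auto)
  also have "\<dots> = circle_mean r (\<lambda>u. f u * cinner (K u *v x) y)"
    by (simp add: cinner_def matrix_vector_mult_def sum_distrib_left sum_distrib_right algebra_simps)
  finally show ?thesis .
qed

text \<open>Together with one further factor, every Newton term has at least two linear factors in
  its denominator, so \<open>circle_mean_inverse_prod\<close> kills it. The multiset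
  \<open>A\<close> collects the factors already peeled off.\<close>

lemma circle_mean_newton_resolvent:
  assumes "admissible r" "set xs \<subseteq> \<phi> ` ball 0 r" "A \<noteq> {#}" "set_mset A \<subseteq> \<phi> ` ball 0 r"
  shows "circle_mean r (\<lambda>u. u * deriv \<phi> u / (\<Prod>l\<in>#A. \<phi> u - l) * cinner (newton_resolvent T xs (\<phi> u) *v x) y) = 0"
  using assms(2-)
proof (induction xs arbitrary: A x)
  case Nil
  then show ?case by (simp add: cinner_def)
next
  case (Cons l xs)
  note r = admissibleD[OF assms(1)]
  define z where "z = T *v x - l *s x"
  define B where "B = add_mset l A"
  have B: "set_mset B \<subseteq> \<phi> ` ball 0 r" "2 \<le> size B"
    using Cons.prems by (auto simp: B_def Suc_le_eq nonempty_has_size)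
  have nz: "\<phi> u - l \<noteq> 0" if "u \<in> sphere 0 r" "l \<in> \<phi> ` ball 0 r" for u l
    using \<phi>_sphere_notin[OF that(1) r(3) that(2)] by simp
  have prodB: "(\<Prod>l\<in>#B. \<phi> u - l) \<noteq> 0" if "u \<in> sphere 0 r" for u
  proof -
    have "\<phi> u \<notin># B" using \<phi>_sphere_notin[OF that r(3)] B(1) by blast
    then show ?thesis by (auto simp: prod_mset_zero_iff)
  qed
  have "set xs \<subseteq> \<phi> ` ball 0 r" using Cons.prems by simp
  then have xs: "\<phi> u \<notin> set xs" if "u \<in> sphere 0 r" for u
    using \<phi>_sphere_notin[OF that r(3)] by blast
  have contB: "continuous_on (sphere 0 r) (\<lambda>u. \<Prod>l\<in>#B. \<phi> u - l)"
    using r by (induction B) (auto intro!: continuous_intros)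
  have cont: "continuous_on (sphere 0 r) (\<lambda>u. u * deriv \<phi> u / (\<Prod>l\<in>#B. \<phi> u - l))"
  proof (rule continuous_on_divide[OF _ contB])
    show "continuous_on (sphere 0 r) (\<lambda>u. u * deriv \<phi> u)"
      using r by (intro continuous_intros) auto
  qed (use prodB in blast)
  have "circle_mean r (\<lambda>u. u * deriv \<phi> u / (\<Prod>l\<in>#A. \<phi> u - l) *
      cinner (newton_resolvent T (l # xs) (\<phi> u) *v x) y) =
      circle_mean r (\<lambda>u. cinner x y * (u * deriv \<phi> u / (\<Prod>l\<in>#B. \<phi> u - l)) +
      u * deriv \<phi> u / (\<Prod>l\<in>#B. \<phi> u - l) * cinner (newton_resolvent T xs (\<phi> u) *v z) y)"
    unfolding newton_resolvent_Cons_vector z_def[symmetric]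
    by (rule circle_mean_cong) (use r in \<open>simp_all add: B_def cinner_add_left algebra_simps add_divide_distrib\<close>)
  also have "\<dots> = circle_mean r (\<lambda>u. cinner x y * (u * deriv \<phi> u / (\<Prod>l\<in>#B. \<phi> u - l))) +
      circle_mean r (\<lambda>u. u * deriv \<phi> u / (\<Prod>l\<in>#B. \<phi> u - l) * cinner (newton_resolvent T xs (\<phi> u) *v z) y)"
    by (intro circle_mean_add cont continuous_on_mult continuous_intros) (use r xs in auto)
  also have "circle_mean r (\<lambda>u. cinner x y * (u * deriv \<phi> u / (\<Prod>l\<in>#B. \<phi> u - l))) = 0"
    by (simp only: circle_mean_cmult circle_mean_inverse_prod[OF r(1,3) B]) simp
  also have "circle_mean r (\<lambda>u. u * deriv \<phi> u / (\<Prod>l\<in>#B. \<phi> u - l) * cinner (newton_resolvent T xs (\<phi> u) *v z) y) = 0"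
    by (rule Cons.IH) (use Cons.prems B B_def in auto)
  finally show ?case by simp
qed

text \<open>The leading Newton term has a single factor in its denominator and mean 1; all later
  terms have mean zero.\<close>

lemma calc_one:
  assumes "admissible r"
  shows "calc r (\<lambda>u. 1) = mat 1"
proof (rule matrix_eq_cinnerI)
  fix x y :: "complex^'n"
  note r = admissibleD[OF assms]
  have eq: "cinner (calc r (\<lambda>u. 1) *v x) y =
      circle_mean r (\<lambda>u. u * deriv \<phi> u * cinner (newton_resolvent T ls (\<phi> u) *v x) y)"
    by (simp add: calc_cinner[OF assms continuous_on_const] K_def R_def mscale_vector)
  show "cinner (calc r (\<lambda>u. 1) *v x) y = cinner (mat 1 *v x) y"
  proof (cases ls)
    case Nil
    then have "mat 1 = (0 :: complex^'n^'n)" using annihilated by (simp add: poly_mat_def)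
    then have "x = 0" by (metis matrix_vector_mul_lid matrix_eq_0_iff)
    then show ?thesis by (simp add: cinner_def)
  next
    case (Cons l xs)
    then have l: "l \<in> \<phi> ` ball 0 r" and xs: "set xs \<subseteq> \<phi> ` ball 0 r" using r by auto
    define z where "z = T *v x - l *s x"
    have nz: "\<phi> u - l \<noteq> 0" if "u \<in> sphere 0 r" for u
      using \<phi>_sphere_notin[OF that r(3) l] by simp
    have xs': "\<phi> u \<notin> set xs" if "u \<in> sphere 0 r" for u
      using \<phi>_sphere_notin[OF that r(3)] xs by blast
    have cont: "continuous_on (sphere 0 r) (\<lambda>u. u * deriv \<phi> u / (\<phi> u - l))"
      by (intro continuous_intros) (use r nz in auto)
    have "circle_mean r (\<lambda>u. u * deriv \<phi> u * cinner (newton_resolvent T ls (\<phi> u) *v x) y) =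
      circle_mean r (\<lambda>u. cinner x y * (u * deriv \<phi> u / (\<phi> u - l)) +
      u * deriv \<phi> u / (\<phi> u - l) * cinner (newton_resolvent T xs (\<phi> u) *v z) y)"
      unfolding newton_resolvent_Cons_vector z_def[symmetric] Cons
      by (rule circle_mean_cong) (use r in \<open>simp_all add: cinner_add_left algebra_simps add_divide_distrib\<close>)
    also have "\<dots> = circle_mean r (\<lambda>u. cinner x y * (u * deriv \<phi> u / (\<phi> u - l))) +
      circle_mean r (\<lambda>u. u * deriv \<phi> u / (\<phi> u - l) * cinner (newton_resolvent T xs (\<phi> u) *v z) y)"
      by (intro circle_mean_add cont continuous_on_mult continuous_intros) (use r xs' in auto)
    also have "circle_mean r (\<lambda>u. cinner x y * (u * deriv \<phi> u / (\<phi> u - l))) = cinner x y"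
      by (simp only: circle_mean_cmult circle_mean_inverse_linear[OF r(1,3) l]) simp
    also have "circle_mean r (\<lambda>u. u * deriv \<phi> u / (\<phi> u - l) * cinner (newton_resolvent T xs (\<phi> u) *v z) y) = 0"
      using circle_mean_newton_resolvent[OF assms xs, of "{#l#}" z y] l by simp
    finally show ?thesis by (simp add: eq)
  qed
qed

lemma calc_linear:
  assumes "admissible r" "continuous_on (sphere 0 r) f" "continuous_on (sphere 0 r) g"
  shows "calc r (\<lambda>z. c * f z + g z) = mscale c (calc r f) + calc r g"
proof -
  have "circle_mean r (\<lambda>u. (c * f u + g u) * K u $ i $ j) =
    c * circle_mean r (\<lambda>u. f u * K u $ i $ j) + circle_mean r (\<lambda>u. g u * K u $ i $ j)" for i j
  proof -
    have "circle_mean r (\<lambda>u. (c * f u + g u) * K u $ i $ j) =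
        circle_mean r (\<lambda>u. c * (f u * K u $ i $ j) + g u * K u $ i $ j)"
      by (simp add: algebra_simps)
    also have "\<dots> = circle_mean r (\<lambda>u. c * (f u * K u $ i $ j)) + circle_mean r (\<lambda>u. g u * K u $ i $ j)"
      by (intro circle_mean_add continuous_intros assms(2,3) K_continuous[OF assms(1)])
         (use admissibleD[OF assms(1)] in auto)
    finally show ?thesis by (simp only: circle_mean_cmult)
  qed
  then show ?thesis by (simp add: calc_def mscale_def vec_eq_iff)
qed

lemma calc_cong:
  assumes "\<And>u. u \<in> sphere 0 r \<Longrightarrow> f u = g u" "0 \<le> r"
  shows "calc r f = calc r g"
proof -
  have "circle_mean r (\<lambda>u. f u * K u $ i $ j) = circle_mean r (\<lambda>u. g u * K u $ i $ j)" for i j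
    by (rule circle_mean_cong) (use assms in auto)
  then show ?thesis by (simp add: calc_def)
qed

text \<open>By \<open>K_right\<close>, multiplying the kernel by \<open>\<phi> u\<close> amounts to
  applying \<open>T\<close>, up to the scalar \<open>u * deriv \<phi> u\<close>. Against
  \<open>f\<close> this scalar is holomorphic and vanishes at 0, hence has mean zero.\<close>

lemma calc_\<phi>:
  assumes r: "admissible r" and f: "f \<in> disk_alg r"
  shows "calc r (\<lambda>u. \<phi> u * f u) = T ** calc r f"
proof (rule matrix_eq_cinnerI)
  fix x y :: "complex^'n"
  note ad = admissibleD[OF r]
  note fs = disk_alg_sphere[OF f]
  have \<phi>s: "continuous_on (sphere 0 r) \<phi>" using \<phi>_disk_alg[OF ad(3)] by (rule disk_alg_sphere)
  have ds: "continuous_on (sphere 0 r) (deriv \<phi>)" using ad by (intro continuous_intros) auto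
  have "cinner (calc r (\<lambda>u. \<phi> u * f u) *v x) y = circle_mean r (\<lambda>u. \<phi> u * f u * cinner (K u *v x) y)"
    by (intro calc_cinner r continuous_intros fs \<phi>s)
  also have "\<dots> = circle_mean r (\<lambda>u. cinner x y * (f u * (u * deriv \<phi> u)) +
      f u * cinner (K u *v x) (adjoint_mat T *v y))"
  proof (rule circle_mean_cong)
    fix u :: complex assume u: "u \<in> sphere 0 r"
    have "\<phi> u * cinner (K u *v x) y = cinner (\<phi> u *s (K u *v x)) y" by simp
    also have "\<phi> u *s (K u *v x) = (u * deriv \<phi> u) *s x + T *v (K u *v x)"
      using K_right[OF r u, of x] by (simp add: algebra_simps)
    also have "cinner \<dots> y = u * deriv \<phi> u * cinner x y + cinner (K u *v x) (adjoint_mat T *v y)"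
      by (simp add: cinner_add_left cinner_adjoint_right)
    finally have "f u * (\<phi> u * cinner (K u *v x) y) =
        f u * (u * deriv \<phi> u * cinner x y + cinner (K u *v x) (adjoint_mat T *v y))" by simp
    then show "\<phi> u * f u * cinner (K u *v x) y =
        cinner x y * (f u * (u * deriv \<phi> u)) + f u * cinner (K u *v x) (adjoint_mat T *v y)"
      by (simp add: algebra_simps)
  qed (use ad in simp)
  also have "\<dots> = circle_mean r (\<lambda>u. cinner x y * (f u * (u * deriv \<phi> u))) +
      circle_mean r (\<lambda>u. f u * cinner (K u *v x) (adjoint_mat T *v y))"
    by (intro circle_mean_add continuous_intros fs ds K_continuous[OF r] ad)
  also have "circle_mean r (\<lambda>u. f u * (u * deriv \<phi> u)) = 0"
    using circle_mean_holomorphic[of r "\<lambda>u. f u * (u * deriv \<phi> u)"]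
      disk_alg_intros(3)[OF f deriv_\<phi>_disk_alg[OF ad(3)]] ad by (simp add: disk_alg_def)
  then have "circle_mean r (\<lambda>u. cinner x y * (f u * (u * deriv \<phi> u))) = 0"
    by (simp only: circle_mean_cmult) simp
  also have "circle_mean r (\<lambda>u. f u * cinner (K u *v x) (adjoint_mat T *v y)) =
      cinner (calc r f *v x) (adjoint_mat T *v y)"
    by (rule calc_cinner[OF r fs, symmetric])
  finally show "cinner (calc r (\<lambda>u. \<phi> u * f u) *v x) y = cinner ((T ** calc r f) *v x) y"
    by (simp add: cinner_adjoint_right flip: matrix_vector_mul_assoc)
qed

lemma calc_poly:
  assumes r: "admissible r" and f: "f \<in> disk_alg r"
  shows "calc r (\<lambda>u. poly p (\<phi> u) * f u) = poly_mat p T ** calc r f"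
proof (induction p)
  case 0
  have "circle_mean r (\<lambda>u. 0 * K u $ i $ j) = 0" for i j by simp
  then show ?case by (simp add: calc_def vec_eq_iff)
next
  case (pCons a p)
  note ad = admissibleD[OF r]
  have pf: "(\<lambda>u. poly p (\<phi> u) * f u) \<in> disk_alg r"
    by (intro disk_alg_intros disk_alg_poly \<phi>_disk_alg ad f)
  have "calc r (\<lambda>u. poly (pCons a p) (\<phi> u) * f u) = calc r (\<lambda>u. a * f u + \<phi> u * (poly p (\<phi> u) * f u))"
    by (simp add: algebra_simps)
  also have "\<dots> = mscale a (calc r f) + calc r (\<lambda>u. \<phi> u * (poly p (\<phi> u) * f u))"
    by (intro calc_linear r disk_alg_sphere disk_alg_intros \<phi>_disk_alg ad f pf)
  also have "calc r (\<lambda>u. \<phi> u * (poly p (\<phi> u) * f u)) = T ** (poly_mat p T ** calc r f)"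
    by (simp add: calc_\<phi>[OF r pf] pCons.IH)
  finally show ?case
    by (simp add: poly_mat_pCons matrix_mult_add_left mscale_mult_left matrix_mul_assoc)
qed

text \<open>Hermite interpolation at the points of \<open>xs\<close>, one point at a time. In the
  disk variable \<open>\<phi> u - l\<close> is \<open>u - z\<close> times the nowhere vanishing
  \<open>dquot u z\<close>, so dividing by it stays within the algebra.\<close>

lemma Hermite_division:
  assumes "set xs \<subseteq> \<phi> ` ball 0 r" "r < s" "f \<in> disk_alg r"
  shows "\<exists>p G. G \<in> disk_alg r \<and>
    (\<forall>u\<in>cball 0 r. f u = poly p (\<phi> u) + poly (\<Prod>l\<leftarrow>xs. [:- l, 1:]) (\<phi> u) * G u)"
  using assms(1,3)
proof (induction xs arbitrary: f)
  case Nil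
  then show ?case by (intro exI[of _ 0] exI[of _ f]) auto
next
  case (Cons l xs)
  obtain z where z: "l = \<phi> z" "norm z < r" using Cons.prems(1) by auto
  obtain g where g: "g \<in> disk_alg r" "\<And>u. f u = f z + (u - z) * g u"
    using disk_alg_difference_quotient[OF Cons.prems(2) z(2)] by blast
  have zs: "z \<in> ball 0 s" using z assms(2) by simp
  have dc: "continuous_on (ball 0 s) (\<lambda>u. dquot u z)"
  proof -
    have "continuous_on (ball 0 s) (\<lambda>u. (\<lambda>(u, z). dquot u z) (u, z))"
      by (rule continuous_on_compose2[OF dquot_continuous]) (use zs in \<open>auto intro!: continuous_intros\<close>)
    then show ?thesis by simp
  qed
  have "(\<lambda>u. dquot u z) holomorphic_on ball 0 s"
  proof (rule no_isolated_singularity[OF dc _ open_ball, of "{z}"])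
    have "(\<lambda>u. (\<phi> u - \<phi> z) / (u - z)) holomorphic_on ball 0 s - {z}"
      by (intro holomorphic_intros holomorphic_on_subset[OF hol_\<phi>]) auto
    then show "(\<lambda>u. dquot u z) holomorphic_on ball 0 s - {z}"
      by (rule holomorphic_transform) (use dquot_eq[OF _ zs] in auto)
  qed simp
  then have "(\<lambda>u. g u / dquot u z) \<in> disk_alg r"
    using g(1) dquot_nz[OF _ zs] assms(2)
    by (auto simp: disk_alg_def intro!: holomorphic_intros continuous_intros
        continuous_on_subset[OF dc] elim: holomorphic_on_subset)
  then obtain p G where G: "G \<in> disk_alg r"
    "\<And>u. u \<in> cball 0 r \<Longrightarrow> g u / dquot u z = poly p (\<phi> u) + poly (\<Prod>l\<leftarrow>xs. [:- l, 1:]) (\<phi> u) * G u"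
    using Cons.IH[of "\<lambda>u. g u / dquot u z"] Cons.prems(1) by auto
  have "f u = poly ([:f z:] + [:- l, 1:] * p) (\<phi> u) + poly (\<Prod>l\<leftarrow>l # xs. [:- l, 1:]) (\<phi> u) * G u"
    if u: "u \<in> cball 0 r" for u
  proof -
    have us: "u \<in> ball 0 s" using u assms(2) by simp
    have "f u = f z + (\<phi> u - l) * (g u / dquot u z)"
      using g(2)[of u] dquot_nz[OF us zs] by (simp add: z(1) dquot_eq[OF us zs])
    then show ?thesis unfolding G(2)[OF u] by (simp add: algebra_simps)
  qed
  then show ?case using G(1) by blast
qed

lemma calc_Hermite:
  assumes r: "admissible r" and G: "G \<in> disk_alg r" and g: "g \<in> disk_alg r"
    and eq: "\<And>u. u \<in> cball 0 r \<Longrightarrow> f u = poly p (\<phi> u) + poly (\<Prod>l\<leftarrow>ls. [:- l, 1:]) (\<phi> u) * G u"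
  shows "calc r (\<lambda>u. f u * g u) = poly_mat p T ** calc r g"
proof -
  note ad = admissibleD[OF r]
  let ?M = "\<Prod>l\<leftarrow>ls. [:- l, 1:]"
  have "calc r (\<lambda>u. f u * g u) = calc r (\<lambda>u. 1 * (poly p (\<phi> u) * g u) + poly ?M (\<phi> u) * (G u * g u))"
    by (rule calc_cong) (use eq ad in \<open>simp_all add: algebra_simps\<close>)
  also have "\<dots> = mscale 1 (calc r (\<lambda>u. poly p (\<phi> u) * g u)) + calc r (\<lambda>u. poly ?M (\<phi> u) * (G u * g u))"
    by (intro calc_linear r disk_alg_sphere disk_alg_intros disk_alg_poly \<phi>_disk_alg ad G g)
  also have "\<dots> = poly_mat p T ** calc r g"
    by (simp add: calc_poly[OF r g] calc_poly[OF r disk_alg_intros(3)[OF G g]] annihilated)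
  finally show ?thesis .
qed

text \<open>Modulo the annihilating polynomial \<open>f\<close> is a polynomial \<open>p\<close> in
  \<open>\<phi>\<close>. Taking \<open>g = 1\<close> in \<open>calc_Hermite\<close> identifies
  \<open>calc r f\<close> with \<open>poly_mat p T\<close>, and general \<open>g\<close> then gives
  the product.\<close>

lemma calc_mult:
  assumes r: "admissible r" and f: "f \<in> disk_alg r" and g: "g \<in> disk_alg r"
  shows "calc r (\<lambda>u. f u * g u) = calc r f ** calc r g"
proof -
  obtain p G where G: "G \<in> disk_alg r"
    "\<And>u. u \<in> cball 0 r \<Longrightarrow> f u = poly p (\<phi> u) + poly (\<Prod>l\<leftarrow>ls. [:- l, 1:]) (\<phi> u) * G u"
    using Hermite_division[OF _ _ f] admissibleD[OF r] by blast
  have "calc r f = poly_mat p T"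
    using calc_Hermite[OF r G(1) disk_alg_intros(1)[of 1] G(2)] by (simp add: calc_one[OF r])
  then show ?thesis using calc_Hermite[OF r G(1) g G(2)] by simp
qed

text \<open>The interpolation on the unit disk restricts to the smaller one, so both sides equal the
  same \<open>poly_mat p T\<close>.\<close>

lemma calc_radius:
  assumes r: "admissible r" and f: "f \<in> disk_alg 1"
  shows "calc r f = calc 1 f"
proof -
  have r1: "r \<le> 1" using admissibleD[OF r] by simp
  obtain p G where G: "G \<in> disk_alg 1"
    "\<And>u. u \<in> cball 0 1 \<Longrightarrow> f u = poly p (\<phi> u) + poly (\<Prod>l\<leftarrow>ls. [:- l, 1:]) (\<phi> u) * G u"
    using Hermite_division[OF _ _ f] admissibleD[OF admissible_1] by blast
  have "calc 1 f = poly_mat p T"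
    using calc_Hermite[OF admissible_1 G(1) disk_alg_intros(1)[of 1] G(2)] by (simp add: calc_one[OF admissible_1])
  moreover have "calc r f = poly_mat p T"
  proof -
    have "G \<in> disk_alg r" using G(1) disk_alg_subset[OF r1] by blast
    from calc_Hermite[OF r this disk_alg_intros(1)[of 1], of f p] show ?thesis
      using G(2) r1 by (simp add: calc_one[OF r])
  qed
  ultimately show ?thesis by simp
qed

lemma calc_poly_\<phi>: "calc 1 (\<lambda>u. poly p (\<phi> u)) = poly_mat p T"
  using calc_poly[OF admissible_1 disk_alg_intros(1)[of 1], of p] by (simp add: calc_one[OF admissible_1])

end

section \<open>Positivity of the resolvent kernel and the norm estimates\<close>

context chart_matrix
begin

text \<open>Applying the calculus to
  \<open>(\<phi> u - \<phi> v) * (1 / (\<phi> u - \<phi> v)) = 1\<close> exhibits the left side as a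
  right inverse of \<open>\<phi> u - T\<close>, while \<open>R u\<close> is a left inverse. The
  condition \<open>r < 1\<close> keeps the pole off the closed disk.\<close>

lemma calc_kernel:
  assumes r: "admissible r" "r < 1" and u: "norm u = 1"
  shows "calc r (\<lambda>v. 1 / (\<phi> u - \<phi> v)) = R u"
proof -
  note ad = admissibleD[OF r(1)]
  have nz: "\<phi> u - \<phi> v \<noteq> 0" if "v \<in> cball 0 r" for v
    using \<phi>_diff_nz[OF u] that r(2) by simp
  let ?g = "\<lambda>v. 1 / (\<phi> u - \<phi> v)"
  have g: "?g \<in> disk_alg r"
    using \<phi>_disk_alg[OF ad(3)] nz by (auto simp: disk_alg_def intro!: continuous_intros holomorphic_intros)
  have "[:\<phi> u, -1:] = smult (-1) [:- \<phi> u, 1:]" by simp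
  then have pm: "poly_mat [:\<phi> u, -1:] T = mscale (\<phi> u) (mat 1) - T"
    by (simp only: poly_mat_smult poly_mat_linear_factor) (simp add: mscale_def vec_eq_iff)
  have "mat 1 = calc r (\<lambda>v. poly [:\<phi> u, -1:] (\<phi> v) * ?g v)"
    unfolding calc_one[OF r(1), symmetric]
    by (rule calc_cong) (use nz ad in auto)
  also have "\<dots> = (mscale (\<phi> u) (mat 1) - T) ** calc r ?g"
    by (simp only: calc_poly[OF r(1) g] pm)
  finally have "R u ** mat 1 = (R u ** (mscale (\<phi> u) (mat 1) - T)) ** calc r ?g"
    by (simp only: matrix_mul_assoc[symmetric])
  then show ?thesis
    using R_left[OF admissible_1, of u] u by simp
qed

text \<open>Evaluating on a smaller circle keeps the two integration variables apart, so that Fubini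
  applies to a continuous integrand.\<close>

lemma calc_alpha_cinner:
  assumes f: "f \<in> disk_algebra"
  shows "cinner (calc 1 (alpha f) *v x) y = circle_mean 1 (\<lambda>u. cnj (f u) * cinner (K u *v x) y)"
proof -
  obtain r where r: "admissible r" "r < 1" using admissible_less_1 by blast
  note ad = admissibleD[OF r(1)]
  have a1: "alpha f \<in> disk_alg 1" using alpha_mem[OF f] by (simp add: disk_alg_1)
  then have ar: "alpha f \<in> disk_alg r" using disk_alg_subset[OF ad(4)] by blast
  define F where "F v u = cnj (f u) * (u * deriv \<phi> u) * (1 / (\<phi> u - \<phi> v) * cinner (K v *v x) y)" for v u
  have nz: "\<phi> u - \<phi> v \<noteq> 0" if "norm u = 1" "norm v = r" for u v
    using \<phi>_diff_nz[OF that(1)] that(2) r(2) by simp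
  have "cinner (calc 1 (alpha f) *v x) y = cinner (calc r (alpha f) *v x) y"
    by (simp add: calc_radius[OF r(1) a1])
  also have "\<dots> = circle_mean r (\<lambda>v. alpha f v * cinner (K v *v x) y)"
    by (rule calc_cinner[OF r(1) disk_alg_sphere[OF ar]])
  also have "\<dots> = circle_mean r (\<lambda>v. circle_mean 1 (F v))"
  proof (rule circle_mean_cong)
    fix v :: complex assume v: "v \<in> sphere 0 r"
    then have "alpha f v = circle_mean 1 (\<lambda>u. cnj (f u) * (u * deriv \<phi> u / (\<phi> u - \<phi> v)))"
      using r(2) by (intro alpha_kernel[OF f]) simp
    then have "alpha f v * cinner (K v *v x) y =
        circle_mean 1 (\<lambda>u. cinner (K v *v x) y * (cnj (f u) * (u * deriv \<phi> u / (\<phi> u - \<phi> v))))"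
      by (simp only: circle_mean_cmult mult.commute)
    also have "\<dots> = circle_mean 1 (F v)"
      by (rule circle_mean_cong) (simp_all add: F_def)
    finally show "alpha f v * cinner (K v *v x) y = circle_mean 1 (F v)" .
  qed (use ad in simp)
  also have "\<dots> = circle_mean 1 (\<lambda>u. circle_mean r (\<lambda>v. F v u))"
  proof (rule circle_mean_swap)
    have c: "continuous_on S (\<lambda>p. f (g p))" if "continuous_on S g" "\<And>p. p \<in> S \<Longrightarrow> norm (g p) = 1"
      for S :: "(complex \<times> complex) set" and g
      by (rule continuous_on_compose2[OF disk_algebraD(3)[OF f] that(1)]) (use that(2) in auto)
    have k: "continuous_on S (\<lambda>p. K (g p))" if "continuous_on S g" "\<And>p. p \<in> S \<Longrightarrow> norm (g p) = r"
      for S :: "(complex \<times> complex) set" and g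
      by (rule continuous_on_compose2[OF K_continuous[OF r(1)] that(1)]) (use that(2) in auto)
    show "continuous_on (sphere 0 r \<times> sphere 0 1) (\<lambda>(v, u). F v u)"
      unfolding F_def case_prod_beta
      by (intro continuous_intros c k) (use nz ad s_gt_1 in auto)
  qed (use ad in auto)
  \<comment> \<open>The integral over \<open>v\<close> is now the calculus applied to a Cauchy
    kernel, which returns the resolvent \<open>R u\<close>.\<close>
  also have "\<dots> = circle_mean 1 (\<lambda>u. cnj (f u) * cinner (K u *v x) y)"
  proof (rule circle_mean_cong)
    fix u :: complex assume "u \<in> sphere 0 1"
    then have u: "norm u = 1" by simp
    have c: "continuous_on (sphere 0 r) (\<lambda>v. 1 / (\<phi> u - \<phi> v))"
      by (intro continuous_intros) (use nz[OF u] ad in auto)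
    have "circle_mean r (\<lambda>v. F v u) = cnj (f u) * (u * deriv \<phi> u) *
        circle_mean r (\<lambda>v. 1 / (\<phi> u - \<phi> v) * cinner (K v *v x) y)"
      unfolding F_def by (rule circle_mean_cmult)
    also have "circle_mean r (\<lambda>v. 1 / (\<phi> u - \<phi> v) * cinner (K v *v x) y) =
        cinner (calc r (\<lambda>v. 1 / (\<phi> u - \<phi> v)) *v x) y"
      by (rule calc_cinner[OF r(1) c, symmetric])
    also have "\<dots> = cinner (R u *v x) y"
      by (simp only: calc_kernel[OF r u])
    finally show "circle_mean r (\<lambda>v. F v u) = cnj (f u) * cinner (K u *v x) y"
      by (simp add: K_def mscale_vector)
  qed simp
  finally show ?thesis .
qed

text \<open>For \<open>y = K u *v x\<close>, solving for \<open>x\<close> writes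
  \<open>cinner x y\<close> as \<open>(norm y)\<^sup>2\<close> times
  \<open>(\<phi> u - w) / (u * deriv \<phi> u)\<close>, where \<open>w\<close> is the Rayleigh
  quotient of \<open>T\<close> at \<open>y\<close>. It lies in the numerical range, so
  \<open>w = \<phi> z\<close> with \<open>norm z < 1\<close>, and \<open>Re_kernel_nonneg\<close>
  applies.\<close>

lemma Re_K_nonneg:
  assumes u: "norm u = 1"
  shows "0 \<le> Re (cinner (K u *v x) x)"
proof -
  have us: "u \<in> sphere 0 1" "u \<in> ball 0 s" using u s_gt_1 by auto
  define y where "y = K u *v x"
  define d where "d = u * deriv \<phi> u"
  have d: "d \<noteq> 0" using deriv_\<phi>_nz[OF us(2)] u by (auto simp: d_def)
  have "d *s x = \<phi> u *s y - T *v y"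
    using K_right[OF admissible_1 us(1), of x] by (simp add: y_def d_def)
  then have "d * cinner x y = \<phi> u * cinner y y - cinner (T *v y) y"
    by (metis cinner_diff_left cinner_scale_left)
  then have xy: "cinner x y = (\<phi> u * cinner y y - cinner (T *v y) y) / d"
    using d by (simp add: field_simps)
  have "0 \<le> Re (cinner x y)"
  proof (cases "y = 0")
    case True
    then show ?thesis by (simp add: cinner_def)
  next
    case False
    then obtain z where z: "cinner (T *v y) y / cinner y y = \<phi> z" "norm z < 1"
      using numerical_range_memI[OF False, of T] W_subset by auto
    have "cinner y y \<noteq> 0" using False cinner_self_eq_0 by blast
    then have "cinner (T *v y) y = \<phi> z * cinner y y" using z(1) by (simp add: field_simps)
    then have "cinner x y = of_real ((norm y)\<^sup>2) * ((\<phi> u - \<phi> z) / d)"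
      unfolding xy norm_cinner by (simp add: algebra_simps)
    then have "Re (cinner x y) = (norm y)\<^sup>2 * Re ((\<phi> u - \<phi> z) / d)"
      by (simp only: Re_complex_of_real Im_complex_of_real times_complex.sel mult_zero_left diff_zero)
    moreover have "0 \<le> Re ((\<phi> u - \<phi> z) / d)"
      unfolding d_def by (rule Re_kernel_nonneg) (use us u z in auto)
    ultimately show ?thesis by simp
  qed
  then show ?thesis
    by (metis y_def cinner_commute complex_cnj(1) complex.sel(1) cnj.simps(1))
qed

text \<open>The Hermitian part of \<open>K u\<close> is nonnegative at \<open>x - c *s y\<close>,
  with \<open>c\<close> the phase of the left side. The additive bound, unlike a product of square
  roots, can be integrated term by term.\<close>

lemma K_Cauchy_Schwarz:
  assumes u: "norm u = 1"
  shows "cmod (cinner (K u *v x) y + cnj (cinner (K u *v y) x)) \<le>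
    Re (cinner (K u *v x) x) + Re (cinner (K u *v y) y)"
proof -
  define q where "q = cinner (K u *v x) y + cnj (cinner (K u *v y) x)"
  define c where "c = (if q = 0 then 1 else q / cmod q)"
  have c: "cmod c = 1" by (simp add: c_def norm_divide)
  then have cc: "c * cnj c = 1" by (simp flip: complex_norm_square)
  have cq: "cnj c * q = of_real (cmod q)"
    by (simp add: c_def complex_norm_square[symmetric] mult.commute power2_eq_square)
  have "cinner (K u *v (x - c *s y)) (x - c *s y) =
      cinner (K u *v x) x - cnj c * cinner (K u *v x) y - c * cinner (K u *v y) x +
      (c * cnj c) * cinner (K u *v y) y"
    by (simp add: matrix_vector_mult_diff_distrib vector_scalar_commute cinner_diff_left cinner_diff_right algebra_simps)
  then have "0 \<le> Re (cinner (K u *v x) x) + Re (cinner (K u *v y) y) -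
      Re (cnj c * cinner (K u *v x) y) - Re (c * cinner (K u *v y) x)"
    using Re_K_nonneg[OF u, of "x - c *s y"] by (simp add: cc)
  also have "Re (c * cinner (K u *v y) x) = Re (cnj c * cnj (cinner (K u *v y) x))"
    by simp
  finally have "Re (cnj c * q) \<le> Re (cinner (K u *v x) x) + Re (cinner (K u *v y) y)"
    by (simp add: q_def algebra_simps)
  then show ?thesis by (simp add: cq q_def[symmetric])
qed

text \<open>Taking the adjoint undoes the conjugate of \<open>f\<close> in \<open>alpha\<close>, so
  both halves of \<open>theta_alpha\<close> integrate the same \<open>f u\<close>, against the
  kernel and its adjoint. The masses of the two diagonal terms are 1 by \<open>calc_one\<close>, and
  the factor 1/2 turns their sum into 1.\<close>

lemma theta_alpha_bound:
  assumes f: "f \<in> disk_algebra" and x: "norm x = 1" and y: "norm y = 1"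
  shows "cmod (cinner (theta_alpha (calc 1) alpha f *v x) y) \<le> supnorm f"
proof -
  note a1 = admissible_1
  have fs: "continuous_on (sphere 0 1) f" using disk_algebraD[OF f] by simp
  note c = continuous_intros fs K_continuous[OF a1]
  define m where "m v = circle_mean 1 (\<lambda>u. cinner (K u *v v) v)" for v
  have m: "m v = 1" if "norm v = 1" for v
    using calc_cinner[OF a1 continuous_on_const, of 1 v v] norm_cinner[of v] that
    by (simp add: m_def calc_one[OF a1])
  have "cinner (adjoint_mat (calc 1 (alpha f)) *v x) y =
      circle_mean 1 (\<lambda>u. f u * cnj (cinner (K u *v y) x))"
    by (simp add: cinner_adjoint calc_alpha_cinner[OF f] flip: circle_mean_cnj)
  then have "cinner (theta_alpha (calc 1) alpha f *v x) y =
      (1/2) * (circle_mean 1 (\<lambda>u. f u * cinner (K u *v x) y) +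
      circle_mean 1 (\<lambda>u. f u * cnj (cinner (K u *v y) x)))"
    by (simp add: theta_alpha_def mscale_vector matrix_vector_mult_add_rdistrib cinner_add_left
        calc_cinner[OF a1 fs])
  also have "\<dots> = (1/2) * circle_mean 1 (\<lambda>u. f u * cinner (K u *v x) y + f u * cnj (cinner (K u *v y) x))"
    by (subst circle_mean_add) (intro c | simp)+
  finally have eq: "cinner (theta_alpha (calc 1) alpha f *v x) y =
      (1/2) * circle_mean 1 (\<lambda>u. f u * cinner (K u *v x) y + f u * cnj (cinner (K u *v y) x))" .
  have "cmod (circle_mean 1 (\<lambda>u. f u * cinner (K u *v x) y + f u * cnj (cinner (K u *v y) x))) \<le>
      Re (circle_mean 1 (\<lambda>u. of_real (supnorm f) * (cinner (K u *v x) x + cinner (K u *v y) y)))"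
  proof (rule circle_mean_norm_le)
    fix u :: complex assume "u \<in> sphere 0 1"
    then have u: "norm u = 1" "u \<in> cball 0 1" by auto
    have "cmod (f u * (cinner (K u *v x) y + cnj (cinner (K u *v y) x))) \<le>
        supnorm f * (Re (cinner (K u *v x) x) + Re (cinner (K u *v y) y))"
      unfolding norm_mult
      by (intro mult_mono norm_le_supnorm f u K_Cauchy_Schwarz supnorm_nonneg) simp
    then show "cmod (f u * cinner (K u *v x) y + f u * cnj (cinner (K u *v y) x)) \<le>
        Re (of_real (supnorm f) * (cinner (K u *v x) x + cinner (K u *v y) y))"
      by (simp add: distrib_left)
  qed (intro c | simp)+
  also have "circle_mean 1 (\<lambda>u. of_real (supnorm f) * (cinner (K u *v x) x + cinner (K u *v y) y)) =
      of_real (supnorm f) * (m x + m y)"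
    unfolding m_def circle_mean_cmult by (subst circle_mean_add) (intro c | simp)+
  finally show ?thesis
    by (simp add: eq norm_mult m x y)
qed

text \<open>A crude constant suffices. It gives the continuity demanded by the hypothesis and bounds
  the set whose supremum is \<open>map_norm\<close>.\<close>

lemma calc_bounded: "\<exists>C\<ge>0. \<forall>f\<in>disk_algebra. mnorm (calc 1 f) \<le> C * supnorm f"
proof -
  have "bounded (K ` sphere 0 1)"
    by (intro compact_imp_bounded compact_continuous_image K_continuous admissible_1 compact_sphere)
  then obtain B where B: "B > 0" "\<And>u. u \<in> sphere 0 1 \<Longrightarrow> norm (K u) \<le> B"
    by (auto simp: bounded_pos)
  have "mnorm (calc 1 f) \<le> (real (CARD('n) * CARD('n)) * B) * supnorm f" if f: "f \<in> disk_algebra" for f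
  proof (rule mnorm_le)
    fix x y :: "complex^'n" assume xy: "norm x = 1" "norm y = 1"
    have "cmod (calc 1 f $ i $ j) \<le> B * supnorm f" for i j
    proof -
      have "cmod (circle_mean 1 (\<lambda>u. f u * K u $ i $ j)) \<le> Re (circle_mean 1 (\<lambda>u. of_real (B * supnorm f) * 1))"
      proof (rule circle_mean_norm_le)
        fix u :: complex assume u: "u \<in> sphere 0 1"
        have "cmod (K u $ i $ j) \<le> B"
          using B(2)[OF u] Finite_Cartesian_Product.norm_nth_le order_trans by metis
        moreover have "cmod (f u) \<le> supnorm f" by (rule norm_le_supnorm[OF f]) (use u in auto)
        ultimately have "cmod (f u) * cmod (K u $ i $ j) \<le> supnorm f * B"
          by (intro mult_mono supnorm_nonneg f) auto
        then show "cmod (f u * K u $ i $ j) \<le> Re (of_real (B * supnorm f) * 1)"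
          by (simp add: norm_mult mult.commute)
      qed (intro continuous_intros disk_algebraD f K_continuous admissible_1 | simp)+
      then show ?thesis by (simp only: circle_mean_cmult) (simp add: calc_def)
    qed
    from cmod_cinner_entries_le[OF this xy]
    show "cmod (cinner (calc 1 f *v x) y) \<le> real (CARD('n) * CARD('n)) * B * supnorm f"
      by (simp add: mult.assoc)
  qed (use B supnorm_nonneg[OF f] in simp)
  then show ?thesis using B by (intro exI[of _ "real (CARD('n) * CARD('n)) * B"]) auto
qed

lemma calc_cont_unital_hom: "cont_unital_hom (calc 1)"
  unfolding cont_unital_hom_def
proof (intro conjI ballI allI)
  show "calc 1 (\<lambda>z. 1) = mat 1" by (rule calc_one[OF admissible_1])
  show "\<exists>C. \<forall>f\<in>disk_algebra. mnorm (calc 1 f) \<le> C * supnorm f" using calc_bounded by blast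
next
  fix f g c assume fg: "f \<in> disk_algebra" "g \<in> disk_algebra"
  show "calc 1 (\<lambda>z. c * f z + g z) = mscale c (calc 1 f) + calc 1 g"
    using fg by (intro calc_linear admissible_1 disk_algebraD)
  show "calc 1 (\<lambda>z. f z * g z) = calc 1 f ** calc 1 g"
    using fg by (intro calc_mult admissible_1) (simp_all add: disk_alg_1)
qed

lemma theta_alpha_contractive: "map_norm (theta_alpha (calc 1) alpha) \<le> 1"
  unfolding map_norm_def
proof (rule cSUP_least)
  have "(\<lambda>z. 0) \<in> {f \<in> disk_algebra. supnorm f \<le> 1}"
    by (auto simp: disk_algebra_def intro: supnorm_le)
  then show "{f \<in> disk_algebra. supnorm f \<le> 1} \<noteq> {}" by blast
next
  fix f assume "f \<in> {f \<in> disk_algebra. supnorm f \<le> 1}"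
  then have f: "f \<in> disk_algebra" "supnorm f \<le> 1" by auto
  show "mnorm (theta_alpha (calc 1) alpha f) \<le> 1"
    by (rule mnorm_le) (use theta_alpha_bound[OF f(1)] f(2) in \<open>auto intro: order_trans\<close>)
qed

lemma poly_mat_bound:
  assumes two: "map_norm (calc 1) \<le> 2" and B: "0 < B" "\<And>w. w \<in> \<Omega> \<Longrightarrow> cmod (poly p w) \<le> B"
  shows "mnorm (poly_mat p T) \<le> 2 * B"
proof -
  define q where "q = smult (of_real (1 / B)) p"
  define f where "f = (\<lambda>u. poly q (\<phi> u))"
  have f: "f \<in> disk_algebra"
    using disk_alg_poly[OF \<phi>_disk_alg[of 1]] s_gt_1 by (simp add: f_def disk_alg_1)
  have "supnorm f \<le> 1"
  proof (rule supnorm_le)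
    fix u :: complex assume "u \<in> cball 0 1"
    then have "cmod (poly p (\<phi> u)) \<le> B" using B(2) \<phi>_mem s_gt_1 by auto
    then show "cmod (f u) \<le> 1" using B(1) by (simp add: f_def q_def norm_divide divide_simps)
  qed
  obtain C where C: "0 \<le> C" "\<And>f. f \<in> disk_algebra \<Longrightarrow> mnorm (calc 1 f) \<le> C * supnorm f"
    using calc_bounded by blast
  \<comment> \<open>A real supremum dominates the members of its set only if the set is bounded
    above.\<close>
  have bdd: "bdd_above ((\<lambda>f. mnorm (calc 1 f)) ` {f \<in> disk_algebra. supnorm f \<le> 1})"
  proof (rule bdd_aboveI2)
    fix g assume "g \<in> {f \<in> disk_algebra. supnorm f \<le> 1}"
    then show "mnorm (calc 1 g) \<le> C"
      using C(2)[of g] mult_left_mono[OF _ C(1), of "supnorm g" 1] by simp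
  qed
  have "mnorm (calc 1 f) \<le> map_norm (calc 1)"
    unfolding map_norm_def by (rule cSUP_upper[OF _ bdd]) (use f \<open>supnorm f \<le> 1\<close> in simp)
  moreover have "calc 1 f = mscale (of_real (1 / B)) (poly_mat p T)"
    by (simp only: f_def calc_poly_\<phi> q_def poly_mat_smult)
  ultimately have "mnorm (mscale (of_real (1 / B)) (poly_mat p T)) \<le> 2"
    using two by simp
  then show ?thesis using B(1) by (simp add: mnorm_mscale norm_divide divide_simps mult.commute)
qed

end

section \<open>The numerical range bound\<close>

text \<open>A Riemann map restricted to a slightly smaller disk, so that no boundary behaviour is needed.\<close>

lemma exists_chart:
  assumes \<Omega>: "open \<Omega>" "convex \<Omega>" "bounded \<Omega>" and W: "compact W" "W \<subseteq> \<Omega>" "W \<noteq> {}"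
  obtains \<phi> \<psi> s where "convex_chart \<phi> \<psi> s \<Omega>" "W \<subseteq> \<phi> ` ball 0 1"
proof -
  have "\<Omega> \<noteq> UNIV" using \<Omega>(3) not_bounded_UNIV by blast
  moreover have "simply_connected \<Omega>" using \<Omega>(2) by (rule convex_imp_simply_connected)
  moreover have "\<Omega> \<noteq> {}" using W by blast
  ultimately obtain f g where fg: "f holomorphic_on \<Omega>" "g holomorphic_on ball 0 1"
    and f: "\<And>w. w \<in> \<Omega> \<Longrightarrow> f w \<in> ball 0 1" "\<And>w. w \<in> \<Omega> \<Longrightarrow> g (f w) = w"
    and g: "\<And>z. z \<in> ball 0 1 \<Longrightarrow> g z \<in> \<Omega>" "\<And>z. z \<in> ball 0 1 \<Longrightarrow> f (g z) = z"
    using Riemann_mapping_theorem[of \<Omega>] \<Omega>(1) by blast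
  have "continuous_on W f"
    using holomorphic_on_imp_continuous_on[OF fg(1)] W(2) by (rule continuous_on_subset)
  then have "continuous_on W (\<lambda>w. norm (f w))" by (intro continuous_intros)
  then obtain w where w: "w \<in> W" "\<And>v. v \<in> W \<Longrightarrow> norm (f v) \<le> norm (f w)"
    using continuous_attains_sup[OF W(1,3)] by blast
  have "norm (f w) < 1" using f(1)[of w] w(1) W(2) by auto
  \<comment> \<open>Any radius between the maximum of \<open>norm (f v)\<close> over
    \<open>W\<close> and 1 will do: after rescaling by \<open>r\<close> the unit disk covers
    \<open>W\<close>, and the chart lives on the disk of radius \<open>1 / r\<close>.\<close>
  then obtain r where r: "norm (f w) < r" "r < 1" using dense by blast
  have r0: "0 < r" using r(1) norm_ge_zero le_less_trans by blast
  have scale: "of_real r * z \<in> ball 0 1" if "z \<in> ball 0 (1 / r)" for z :: complex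
    using that r0 by (simp add: norm_mult field_simps)
  have "convex_chart (\<lambda>z. g (of_real r * z)) (\<lambda>w. f w / of_real r) (1 / r) \<Omega>"
  proof
    show "(\<lambda>z. g (of_real r * z)) holomorphic_on ball 0 (1 / r)"
      by (rule holomorphic_on_compose_gen[OF _ fg(2), unfolded o_def])
         (use scale in \<open>auto intro!: holomorphic_intros\<close>)
    show "(\<lambda>w. f w / of_real r) holomorphic_on \<Omega>"
      using r0 by (intro holomorphic_intros fg) auto
    show "f w / of_real r \<in> ball 0 (1 / r)" if "w \<in> \<Omega>" for w
      using f(1)[OF that] r0 by (simp add: norm_divide divide_strict_right_mono)
  qed (use r r0 \<Omega> f g scale in auto)
  moreover have "v \<in> (\<lambda>z. g (of_real r * z)) ` ball 0 1" if "v \<in> W" for v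
  proof
    show "v = g (of_real r * (f v / of_real r))" using f(2)[of v] that W(2) r0 by auto
    show "f v / of_real r \<in> ball 0 1" using w(2)[OF that] r r0 by (simp add: norm_divide)
  qed
  ultimately show ?thesis using that by blast
qed

theorem theorem1p3:
  fixes dummy :: "'n::finite itself"
  assumes H: "\<forall>(\<theta> :: (complex \<Rightarrow> complex) \<Rightarrow> complex^'n^'n) \<alpha>.
      cont_unital_hom \<theta> \<and> unital_antilinear_contraction \<alpha> \<and>
      map_norm (theta_alpha \<theta> \<alpha>) \<le> 1 \<longrightarrow> map_norm \<theta> \<le> 2"
  shows "\<forall>(T :: complex^'n^'n) (p :: complex poly).
      mnorm (poly_mat p T) \<le> 2 * (SUP z\<in>numerical_range T. cmod (poly p z))"
proof (intro allI)
  fix T :: "complex^'n^'n" and p :: "complex poly"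
  define W where "W = numerical_range T"
  define m where "m = (SUP z\<in>W. cmod (poly p z))"
  have W: "compact W" "convex W" "W \<noteq> {}"
    unfolding W_def by (rule compact_numerical_range convex_numerical_range numerical_range_nonempty)+
  have bdd: "bdd_above ((\<lambda>z. cmod (poly p z)) ` W)"
    by (intro bounded_imp_bdd_above compact_imp_bounded compact_continuous_image continuous_intros W)
  have le_m: "cmod (poly p z) \<le> m" if "z \<in> W" for z
    unfolding m_def using that bdd by (rule cSUP_upper)
  have m0: "0 \<le> m" using W(3) le_m norm_ge_zero order_trans by blast
  obtain ls where ls: "poly_mat (\<Prod>l\<leftarrow>ls. [:- l, 1:]) T = 0" "set ls \<subseteq> W"
    unfolding W_def by (rule annihilating_eigenvalues)
  \<comment> \<open>The slack \<open>e\<close> leaves room for a neighbourhood of \<open>W\<close>,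
    and it keeps the bound positive when \<open>p\<close> vanishes on \<open>W\<close>, as
    \<open>poly_mat_bound\<close> divides by it.\<close>
  have bound: "mnorm (poly_mat p T) \<le> 2 * (m + e)" if e: "0 < e" for e
  proof -
    define U where "U = {z. cmod (poly p z) < m + e}"
    have "open U" unfolding U_def by (intro open_Collect_less continuous_intros)
    moreover have "W \<subseteq> U" using le_m e by (force simp: U_def)
    ultimately obtain d where d: "0 < d" "(\<Union>x\<in>W. ball x d) \<subseteq> U"
      using compact_subset_open_imp_ball_epsilon_subset[OF W(1)] by blast
    \<comment> \<open>The \<open>d\<close>-neighbourhood of \<open>W\<close> as a Minkowski sum,
      which inherits convexity from \<open>W\<close> and the ball.\<close>
    define \<Omega> where "\<Omega> = (\<Union>x\<in>W. \<Union>y\<in>ball 0 d. {x + y})"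
    have "open \<Omega>" "convex \<Omega>" "bounded \<Omega>"
      unfolding \<Omega>_def by (auto intro!: open_sums convex_sums bounded_sums W compact_imp_bounded[OF W(1)])
    moreover have "W \<subseteq> \<Omega>"
    proof
      fix x assume "x \<in> W"
      moreover have "x \<in> {x + 0}" "0 \<in> ball (0::complex) d" using d(1) by auto
      ultimately show "x \<in> \<Omega>" unfolding \<Omega>_def by blast
    qed
    ultimately obtain \<phi> \<psi> s where chart: "convex_chart \<phi> \<psi> s \<Omega>" "W \<subseteq> \<phi> ` ball 0 1"
      using exists_chart[of \<Omega> W] W by blast
    interpret convex_chart \<phi> \<psi> s \<Omega> by (rule chart(1))
    interpret chart_matrix \<phi> \<psi> s \<Omega> T ls
      by unfold_locales (use ls chart(2) in \<open>auto simp: W_def\<close>)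
    have "map_norm (calc 1) \<le> 2"
      using H calc_cont_unital_hom alpha_unital_antilinear_contraction theta_alpha_contractive by blast
    moreover have "cmod (poly p w) \<le> m + e" if w: "w \<in> \<Omega>" for w
    proof -
      obtain x y where "x \<in> W" "norm y < d" "w = x + y" using w by (auto simp: \<Omega>_def)
      then have "w \<in> (\<Union>x\<in>W. ball x d)" by (auto simp: dist_norm intro!: bexI[of _ x])
      then have "w \<in> U" using d(2) by blast
      then show ?thesis by (simp add: U_def)
    qed
    ultimately show ?thesis by (intro poly_mat_bound) (use e m0 in auto)
  qed
  have "mnorm (poly_mat p T) \<le> 2 * m + e" if "0 < e" for e
    using bound[of "e / 2"] that by simp
  then show "mnorm (poly_mat p T) \<le> 2 * (SUP z\<in>numerical_range T. cmod (poly p z))"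
    unfolding m_def W_def by (rule field_le_epsilon)
qed

end
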